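(* Let $\Gamma=(G,\sigma)$ be a connected signed graph with $G=(V,E,w,\mu,\kappa)$ and $\kappa\geq0$. Let $\lambda^\sigma_1\le\cdots\le\lambda^\sigma_n$ be the eigenvalues of the normalized Laplacian of $\Gamma$, and $\ell=|E|-|V|+1$. Then for every integer $k$ with $\ell+1\le k\le n$, $$\rho^\sigma_{k-\ell}(\Gamma)\leq\sqrt{2\tau_\Gamma\lambda^\sigma_k},$$ where $\tau_\Gamma=\max_{i\in V}d(i)/\mu_i$.
   Context: $G$ is a finite simple connected graph, $V=\{1,\dots,n\}$, with edge weights $w:E\to\mathbb{R}_{>0}$, vertex measure $\mu:V\to\mathbb{R}_{>0}$, potential $\kappa:V\to\mathbb{R}$; $\sigma:E\to\{-1,+1\}$ is a signature. The signed adjacency matrix $A^\sigma$ has $a_{ij}=\sigma_{ij}w_{ij}$ if $i\sim j$, else $0$; $d(i)=\sum_{j\sim i}w_{ij}$; $D,K,M$ are diagonal with entries $d(i),\kappa_i,\mu_i$; the normalized Laplacian is $\mathfrak{L}^\sigma=M^{-1}(D-A^\sigma+K)$. For $V_1,V_2\subset V$: $|E^{\pm}(V_1,V_2)|=\sum_{x\in V_1}\sum_{y\in V_2,\sigma_{xy}=\pm1}w_{xy}$, $|E^\pm(V_1)|=|E^\pm(V_1,V_1)|$, $|\partial V_1|=\sum_{x\in V_1}\sum_{y\notin V_1}w_{xy}$, and $\beta^\sigma(V_1,V_2)=\frac{2|E^+(V_1,V_2)|+|E^-(V_1)|+|E^-(V_2)|+|\partial(V_1\cup V_2)|}{\sum_{x\in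 V_1\cup V_2}\mu_x}$. The $k$-way signed Cheeger constant is $\rho^\sigma_k(\Gamma)=\min\max_{1\le i\le k}\beta^\sigma(V_{2i-1},V_{2i})$, the minimum over all $k$-sub-bipartitions $\{(V_{2i-1},V_{2i})\}_{i=1}^k$: $V_{2l-1}\cap V_{2l}=\emptyset$, $V_{2l-1}\cup V_{2l}\neq\emptyset$, and $(V_{2i-1}\cup V_{2i})\cap(V_{2j-1}\cup V_{2j})=\emptyset$ for $i\neq j$. *)

theory Defs
  imports Complex_Main "HOL-Computational_Algebra.Polynomial" "Jordan_Normal_Form.Char_Poly"
begin

text \<open>
  The vertex set \<open>{1,\<dots>,n}\<close> is shifted to \<open>{..<n}\<close>, the index set of the rows and columns of an
  \<open>n \<times> n\<close> matrix. Edges are two-element sets of vertices. Weights and signs are functions of edges,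
  the vertex measure and the potential are functions of vertices; their values outside the graph
  are irrelevant.
\<close>

record signed_graph =
  nverts :: nat
  edges :: "nat set set"
  weight :: "nat set \<Rightarrow> real"
  vmeasure :: "nat \<Rightarrow> real"
  potential :: "nat \<Rightarrow> real"
  edge_sign :: "nat set \<Rightarrow> real"

definition verts :: "signed_graph \<Rightarrow> nat set" where
  "verts \<Gamma> = {..<nverts \<Gamma>}"

definition adj :: "signed_graph \<Rightarrow> nat \<Rightarrow> nat \<Rightarrow> bool" where
  "adj \<Gamma> x y \<longleftrightarrow> {x, y} \<in> edges \<Gamma>"

definition wf_signed_graph :: "signed_graph \<Rightarrow> bool" where
  "wf_signed_graph \<Gamma> \<longleftrightarrow>
     (\<forall>e\<in>edges \<Gamma>. e \<subseteq> verts \<Gamma> \<and> card e = 2) \<and>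
     (\<forall>e\<in>edges \<Gamma>. weight \<Gamma> e > 0) \<and>
     (\<forall>x\<in>verts \<Gamma>. vmeasure \<Gamma> x > 0) \<and>
     (\<forall>e\<in>edges \<Gamma>. edge_sign \<Gamma> e \<in> {-1, 1})"

definition connected_graph :: "signed_graph \<Rightarrow> bool" where
  "connected_graph \<Gamma> \<longleftrightarrow>
     verts \<Gamma> \<noteq> {} \<and> (\<forall>x\<in>verts \<Gamma>. \<forall>y\<in>verts \<Gamma>. (adj \<Gamma>)\<^sup>*\<^sup>* x y)"

definition cyclomatic :: "signed_graph \<Rightarrow> int" where
  "cyclomatic \<Gamma> = int (card (edges \<Gamma>)) - int (card (verts \<Gamma>)) + 1"


definition wdegree :: "signed_graph \<Rightarrow> nat \<Rightarrow> real" where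
  "wdegree \<Gamma> x = (\<Sum>y | y \<in> verts \<Gamma> \<and> adj \<Gamma> x y. weight \<Gamma> {x, y})"

definition tau :: "signed_graph \<Rightarrow> real" where
  "tau \<Gamma> = Max ((\<lambda>x. wdegree \<Gamma> x / vmeasure \<Gamma> x) ` verts \<Gamma>)"

definition signed_adjacency :: "signed_graph \<Rightarrow> real mat" where
  "signed_adjacency \<Gamma> = mat (nverts \<Gamma>) (nverts \<Gamma>)
     (\<lambda>(x, y). if adj \<Gamma> x y then edge_sign \<Gamma> {x, y} * weight \<Gamma> {x, y} else 0)"

text \<open>The first factor is the inverse of the diagonal matrix of the (positive) vertex measures.\<close>

definition normalized_laplacian :: "signed_graph \<Rightarrow> real mat" where
  "normalized_laplacian \<Gamma> =
     mat_diag (nverts \<Gamma>) (\<lambda>x. 1 / vmeasure \<Gamma> x) *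
     (mat_diag (nverts \<Gamma>) (wdegree \<Gamma>) - signed_adjacency \<Gamma>
       + mat_diag (nverts \<Gamma>) (potential \<Gamma>))"

text \<open>
  The eigenvalues are listed in increasing order, with multiplicity as roots of the characteristic
  polynomial. The normalized Laplacian is similar to a real symmetric matrix, so that this
  polynomial splits over the reals and there are \<open>n\<close> eigenvalues. They are numbered from 1.
\<close>

definition eigenvalue_seq :: "signed_graph \<Rightarrow> nat \<Rightarrow> real" where
  "eigenvalue_seq \<Gamma> k =
     sorted_list_of_multiset (proots (char_poly (normalized_laplacian \<Gamma>))) ! (k - 1)"


text \<open>
  \<open>signed_edges s \<Gamma> A B\<close> is $|E^{+}(A,B)|$ for \<open>s = 1\<close> and $|E^{-}(A,B)|$ for \<open>s = -1\<close>. The sum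
  is over ordered pairs, so an edge with both endpoints in \<open>A \<inter> B\<close> is counted twice.
\<close>

definition signed_edges :: "real \<Rightarrow> signed_graph \<Rightarrow> nat set \<Rightarrow> nat set \<Rightarrow> real" where
  "signed_edges s \<Gamma> A B =
     (\<Sum>x\<in>A. \<Sum>y | y \<in> B \<and> adj \<Gamma> x y \<and> edge_sign \<Gamma> {x, y} = s. weight \<Gamma> {x, y})"

definition boundary_weight :: "signed_graph \<Rightarrow> nat set \<Rightarrow> real" where
  "boundary_weight \<Gamma> A = (\<Sum>x\<in>A. \<Sum>y | y \<in> verts \<Gamma> - A \<and> adj \<Gamma> x y. weight \<Gamma> {x, y})"

definition beta :: "signed_graph \<Rightarrow> nat set \<Rightarrow> nat set \<Rightarrow> real" where
  "beta \<Gamma> A B =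
     (2 * signed_edges 1 \<Gamma> A B + signed_edges (-1) \<Gamma> A A + signed_edges (-1) \<Gamma> B B
       + boundary_weight \<Gamma> (A \<union> B)) / (\<Sum>x\<in>A \<union> B. vmeasure \<Gamma> x)"

text \<open>The sets \<open>V 1, \<dots>, V (2 * k)\<close> form a \<open>k\<close>-sub-bipartition; other values of \<open>V\<close> are arbitrary.\<close>

definition sub_bipartition :: "signed_graph \<Rightarrow> nat \<Rightarrow> (nat \<Rightarrow> nat set) \<Rightarrow> bool" where
  "sub_bipartition \<Gamma> k V \<longleftrightarrow>
     (\<forall>i\<in>{1..2 * k}. V i \<subseteq> verts \<Gamma>) \<and>
     (\<forall>l\<in>{1..k}. V (2 * l - 1) \<inter> V (2 * l) = {} \<and> V (2 * l - 1) \<union> V (2 * l) \<noteq> {}) \<and>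
     (\<forall>i\<in>{1..k}. \<forall>j\<in>{1..k}. i \<noteq> j \<longrightarrow>
        (V (2 * i - 1) \<union> V (2 * i)) \<inter> (V (2 * j - 1) \<union> V (2 * j)) = {})"

text \<open>
  For \<open>1 \<le> k \<le> n\<close> the minimum below is over a nonempty finite set of reals: only finitely many
  values \<open>beta \<Gamma> A B\<close> occur.
\<close>

definition cheeger :: "signed_graph \<Rightarrow> nat \<Rightarrow> real" where
  "cheeger \<Gamma> k =
     Min {Max ((\<lambda>i. beta \<Gamma> (V (2 * i - 1)) (V (2 * i))) ` {1..k}) | V. sub_bipartition \<Gamma> k V}"

end

theory Submission
  imports Defs "HOL-Library.Disjoint_Sets" "HOL-Library.Function_Algebras"
    "HOL-Analysis.L2_Norm" "Jordan_Normal_Form.Schur_Decomposition"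
begin

text \<open>
  Let $q$ be the quadratic form of the Laplacian shifted by the $k$-th eigenvalue. Deleting a set
  $R$ of at most $\ell$ vertices turns the graph into a forest. In a rooted forest, repeatedly cut
  off a minimal branch on which $q$ is not positive definite, until $q$ is positive definite on
  what remains. If $S$ is the set of the roots of these branches, then $q$ is positive definite on the
  functions that vanish on $R \cup S$, since removing the root of a minimal branch leaves smaller
  branches that are not adjacent to anything else. By the min-max principle $k \le |R| + |S|$, so
  at least $k - \ell$ branches were cut off. They are disjoint, and each carries a nonzero
  function with Rayleigh quotient at most the $k$-th eigenvalue. The signed Cheeger
  inequality, applied to each of these functions, gives the sub-bipartition.
\<close>

section \<open>Cutting branches off a forest\<close>

text \<open>Vertices are deleted, not edges: vanishing at a vertex is one linear condition and
  leaves q itself intact, so each vertex of \<open>R\<close> and \<open>S\<close> costs one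
  dimension in the min-max count, whereas removing an edge would change the operator. The shift is
  by the k-th eigenvalue exactly. Where strict positivity fails, there is a nonzero function with
  Rayleigh quotient at most that eigenvalue; where it holds, it contradicts the weak inequality
  satisfied by the min-max function. Repeated eigenvalues therefore need no separate treatment.
  Branches are chosen by the sign of a quadratic form rather than by the zeros of an eigenfunction,
  so eigenfunctions that vanish at vertices are no obstacle. In return the Cheeger estimate has to
  accept arbitrary test functions f; it is a coarea argument for f^2, and the constant 2 beside
  \<open>tau\<close> comes from Cauchy-Schwarz together with (|a| + |b|)^2 \<le> 2 a^2 + 2
  b^2.\<close>

definition quad_form :: "'a set \<Rightarrow> ('a \<Rightarrow> 'a \<Rightarrow> real) \<Rightarrow> ('a \<Rightarrow> real) \<Rightarrow> real" where
  "quad_form V B f = (\<Sum>x\<in>V. \<Sum>y\<in>V. B x y * f x * f y)"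

text \<open>Only the support of \<open>f\<close> is restricted, so principal submatrices need no new
  index set: deleting vertices from the graph means shrinking \<open>U\<close> while
  \<open>V\<close> and \<open>B\<close> stay fixed.\<close>

definition pos_def_on :: "'a set \<Rightarrow> ('a \<Rightarrow> 'a \<Rightarrow> real) \<Rightarrow> 'a set \<Rightarrow> bool" where
  "pos_def_on V B U \<longleftrightarrow>
     (\<forall>f. (\<forall>x. x \<notin> U \<longrightarrow> f x = 0) \<longrightarrow> (\<exists>x. f x \<noteq> 0) \<longrightarrow> quad_form V B f > 0)"

lemma pos_def_onD:
  "\<lbrakk>pos_def_on V B U; \<And>x. x \<notin> U \<Longrightarrow> f x = 0; f x \<noteq> 0\<rbrakk> \<Longrightarrow> quad_form V B f > 0"
  unfolding pos_def_on_def by blast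

lemma pos_def_on_nonneg:
  assumes "pos_def_on V B U" "\<And>x. x \<notin> U \<Longrightarrow> f x = (0::real)"
  shows "quad_form V B f \<ge> 0"
proof (cases "\<exists>x. f x \<noteq> 0")
  case True
  then show ?thesis using pos_def_onD[OF assms] by force
next
  case False
  then show ?thesis by (simp add: quad_form_def)
qed

lemma pos_def_on_subset: "\<lbrakk>pos_def_on V B U; W \<subseteq> U\<rbrakk> \<Longrightarrow> pos_def_on V B W"
  unfolding pos_def_on_def by blast

lemma pos_def_on_empty [simp]: "pos_def_on V B {}"
  unfolding pos_def_on_def by simp

lemma quad_form_split:
  assumes sym: "\<And>x y. B x y = B y x"
    and cut: "\<And>x y. \<lbrakk>x \<in> G; y \<in> H\<rbrakk> \<Longrightarrow> B x y = 0"
    and supp: "\<And>x. x \<notin> G \<union> H \<Longrightarrow> f x = (0::real)"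
  shows "quad_form V B f = quad_form V B (\<lambda>x. if x \<in> G then f x else 0)
                         + quad_form V B (\<lambda>x. if x \<in> G then 0 else f x)"
proof -
  have "B x y * f x * f y = (B x y :: real) * (if x \<in> G then f x else 0) * (if y \<in> G then f y else 0)
        + B x y * (if x \<in> G then 0 else f x) * (if y \<in> G then 0 else f y)" for x y
    using cut[of x y] cut[of y x] sym[of x y] supp[of x] supp[of y] by auto
  then show ?thesis
    unfolding quad_form_def by (simp only: sum.distrib)
qed

text \<open>The form is block diagonal, hence a sum of two nonnegative values, and a point where
  \<open>f\<close> is nonzero makes the value of its block positive.\<close>

lemma pos_def_on_Un:
  assumes sym: "\<And>x y. B x y = B y x"
    and cut: "\<And>x y. \<lbrakk>x \<in> G; y \<in> H\<rbrakk> \<Longrightarrow> B x y = 0"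
    and G: "pos_def_on V B G" and H: "pos_def_on V B H"
  shows "pos_def_on V B (G \<union> H)"
  unfolding pos_def_on_def
proof (intro allI impI, elim exE)
  fix f :: "'a \<Rightarrow> real" and z assume supp: "\<forall>x. x \<notin> G \<union> H \<longrightarrow> f x = 0" and z: "f z \<noteq> 0"
  let ?g = "\<lambda>x. if x \<in> G then f x else 0" and ?h = "\<lambda>x. if x \<in> G then 0 else f x"
  have split: "quad_form V B f = quad_form V B ?g + quad_form V B ?h"
    using supp by (intro quad_form_split[OF sym cut]) auto
  have "quad_form V B ?g \<ge> 0" by (rule pos_def_on_nonneg[OF G]) simp
  moreover have "quad_form V B ?h \<ge> 0" by (rule pos_def_on_nonneg[OF H]) (use supp in simp)
  moreover have "quad_form V B ?g > 0 \<or> quad_form V B ?h > 0"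
  proof (cases "z \<in> G")
    case True
    then show ?thesis using z by (intro disjI1 pos_def_onD[OF G, of _ z]) auto
  next
    case False
    then show ?thesis using z supp by (intro disjI2 pos_def_onD[OF H, of _ z]) auto
  qed
  ultimately show "quad_form V B f > 0" using split by linarith
qed

text \<open>A nonzero off-diagonal entry of \<open>B\<close> acts as an edge and the neighbour of
  smaller rank as the parent. For symmetric \<open>B\<close>, uniqueness of parents gives
  acyclicity: the vertex of largest rank on a cycle would have two smaller neighbours.\<close>

definition forest_order :: "('a \<Rightarrow> 'a \<Rightarrow> real) \<Rightarrow> ('a \<Rightarrow> nat) \<Rightarrow> 'a set \<Rightarrow> bool" where
  "forest_order B r U \<longleftrightarrow> inj_on r U \<and>
     (\<forall>x\<in>U. \<forall>y\<in>U. \<forall>z\<in>U. B x y \<noteq> 0 \<longrightarrow> B x z \<noteq> 0 \<longrightarrow> r y < r x \<longrightarrow> r z < r x \<longrightarrow> y = z)"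

lemma forest_order_subset: "\<lbrakk>forest_order B r U; W \<subseteq> U\<rbrakk> \<Longrightarrow> forest_order B r W"
  unfolding forest_order_def by (meson inj_on_subset subset_iff)

text \<open>Let vertices be added in order of decreasing rank until positive definiteness first
  fails, at \<open>v\<close>, and let \<open>D\<close> be the descendants of \<open>v\<close>. The
  vertices added so far that lie outside \<open>D\<close> are separated from it and still positive
  definite, so the failure already occurs on \<open>D\<close>; without \<open>v\<close> it
  disappears.\<close>

lemma forest_branch:
  fixes r :: "'a \<Rightarrow> nat"
  assumes "finite U" and order: "forest_order B r U"
    and sym: "\<And>x y. B x y = B y x"
    and npd: "\<not> pos_def_on V B U"
  obtains v D where "v \<in> D" "D \<subseteq> U" "\<not> pos_def_on V B D" "pos_def_on V B (D - {v})"
    "\<And>x y. \<lbrakk>x \<in> D - {v}; y \<in> U - D\<rbrakk> \<Longrightarrow> B x y = 0"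
proof -
  have inj: "inj_on r U"
    and forest: "\<lbrakk>x \<in> U; y \<in> U; z \<in> U; B x y \<noteq> 0; B x z \<noteq> 0; r y < r x; r z < r x\<rbrakk> \<Longrightarrow> y = z"
    for x y z using order unfolding forest_order_def by blast+
  define T where "T i = {x \<in> U. r x \<ge> i}" for i
  define m where "m = Suc (Max (r ` U))"
  have Tm: "T m = {}"
    using \<open>finite U\<close> unfolding T_def m_def by (auto simp: Suc_le_eq dest: Max_ge[OF finite_imageI] leD)
  have bound: "i \<le> m" if "\<not> pos_def_on V B (T i)" for i
  proof (rule ccontr)
    assume "\<not> i \<le> m"
    then have "T i \<subseteq> T m" unfolding T_def by auto
    with Tm that show False by simp
  qed
  have T0: "\<not> pos_def_on V B (T 0)" using npd by (simp add: T_def)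
  define i where "i = (GREATEST i. \<not> pos_def_on V B (T i))"
  have i: "\<not> pos_def_on V B (T i)"
    unfolding i_def using T0 bound by (rule GreatestI_nat)
  have iSuc: "pos_def_on V B (T (Suc i))"
  proof (rule ccontr)
    assume "\<not> pos_def_on V B (T (Suc i))"
    then have "Suc i \<le> i" unfolding i_def by (rule Greatest_le_nat) (rule bound)
    then show False by simp
  qed
  have "T i \<noteq> T (Suc i)" using i iSuc by auto
  then obtain v where v: "v \<in> U" "r v = i"
    unfolding T_def by (auto simp: Suc_le_eq le_less)
  have Ti: "T i = insert v (T (Suc i))"
    using v inj unfolding T_def by (auto simp: inj_on_def Suc_le_eq le_less)
  define child where "child x y \<longleftrightarrow> x \<in> U \<and> y \<in> U \<and> B x y \<noteq> 0 \<and> r x < r y" for x y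
  define D where "D = {x. child\<^sup>*\<^sup>* v x}"
  have vD: "v \<in> D" by (simp add: D_def)
  have up: "y \<in> D" if "x \<in> D" "child x y" for x y
    using that unfolding D_def by (auto intro: rtranclp.rtrancl_into_rtrancl)
  have Dsub: "x \<in> T i" if "x \<in> D" for x
  proof -
    have "child\<^sup>*\<^sup>* v x" using that by (simp add: D_def)
    then show ?thesis
      by (induction rule: rtranclp_induct) (use v in \<open>auto simp: T_def child_def\<close>)
  qed
  have DU: "D \<subseteq> U" using Dsub by (auto simp: T_def)
  \<comment> \<open>Only \<open>v\<close> can have its parent outside \<open>D\<close>: a lower
    neighbour of \<open>x\<close> is its parent, which was passed on the way from \<open>v\<close>,
    and a higher neighbour is a child.\<close>
  have closed: "B x y = 0" if "x \<in> D - {v}" "y \<in> U - D" for x y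
  proof (rule ccontr)
    assume nz: "B x y \<noteq> 0"
    have xU: "x \<in> U" "y \<in> U" "x \<noteq> y" using that DU by auto
    from that have "child\<^sup>*\<^sup>* v x" "x \<noteq> v" by (auto simp: D_def)
    then obtain p where p: "child\<^sup>*\<^sup>* v p" "child p x" by (auto elim: rtranclp.cases)
    show False
    proof (cases "r y < r x")
      case True
      then have "y = p"
        using p(2) xU nz by (intro forest[of x y p]) (auto simp: child_def sym[of x p])
      then show False using p that by (simp add: D_def)
    next
      case False
      then have "r x < r y" using xU inj by (metis inj_onD linorder_neqE_nat)
      then have "child x y" using xU nz by (simp add: child_def)
      then show False using up[of x y] that by auto
    qed
  qed
  \<comment> \<open>Inside \<open>T i\<close> even \<open>v\<close> is harmless: the other vertices
    there have larger rank, so its neighbours among them are children.\<close>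
  have cutT: "B x y = 0" if "x \<in> D" "y \<in> T i - D" for x y
  proof (cases "x = v")
    case True
    have "y \<in> T (Suc i)" using that Ti vD by auto
    then have "\<not> child v y \<Longrightarrow> B v y = 0" using v by (auto simp: child_def T_def)
    then show ?thesis using up[OF vD, of y] that True by auto
  next
    case False
    then show ?thesis using that closed[of x y] by (auto simp: T_def)
  qed
  have "\<not> pos_def_on V B D"
  proof
    assume pD: "pos_def_on V B D"
    have "pos_def_on V B (T i - D)"
      by (rule pos_def_on_subset[OF iSuc]) (use Ti vD in auto)
    then have "pos_def_on V B (D \<union> (T i - D))"
      by (intro pos_def_on_Un[OF sym cutT pD])
    moreover have "D \<union> (T i - D) = T i" using Dsub by auto
    ultimately show False using i by simp
  qed
  moreover have "pos_def_on V B (D - {v})"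
    by (rule pos_def_on_subset[OF iSuc]) (use Ti Dsub in auto)
  ultimately show thesis using that[of v D] vD DU closed by blast
qed

text \<open>Each cut pays for one root in \<open>S\<close> with one branch in \<open>F\<close>.
  Deleting the root leaves \<open>D - {v}\<close>, which is positive definite and separated from the
  rest, so the result for \<open>U - D\<close> extends to \<open>U\<close>.\<close>

lemma forest_packing:
  fixes r :: "'a \<Rightarrow> nat"
  assumes "finite U" "forest_order B r U"
    and sym: "\<And>x y. B x y = B y x"
  shows "\<exists>S F. S \<subseteq> U \<and> finite F \<and> card S \<le> card F \<and> disjoint F \<and>
           (\<forall>C\<in>F. C \<subseteq> U \<and> \<not> pos_def_on V B C) \<and> pos_def_on V B (U - S)"
  using assms(1,2)
proof (induction "card U" arbitrary: U rule: less_induct)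
  case less
  show ?case
  proof (cases "pos_def_on V B U")
    case True
    then show ?thesis by (intro exI[of _ "{}"]) auto
  next
    case False
    obtain v D where D: "v \<in> D" "D \<subseteq> U" "\<not> pos_def_on V B D" "pos_def_on V B (D - {v})"
      and cut: "\<And>x y. \<lbrakk>x \<in> D - {v}; y \<in> U - D\<rbrakk> \<Longrightarrow> B x y = 0"
      by (rule forest_branch[OF less.prems sym False]) (rule that)
    have smaller: "card (U - D) < card U"
      using D less.prems(1) by (intro psubset_card_mono) auto
    obtain S F where F: "S \<subseteq> U - D" "finite F" "card S \<le> card F" "disjoint F"
      "\<forall>C\<in>F. C \<subseteq> U - D \<and> \<not> pos_def_on V B C" "pos_def_on V B (U - D - S)"
      using less.hyps[OF smaller _ forest_order_subset[OF less.prems(2)]] less.prems(1) by auto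
    \<comment> \<open>\<open>D\<close> has to be new: otherwise \<open>card F\<close> would not grow
      along with \<open>card S\<close>.\<close>
    have "D \<notin> F" using F(5) D(1) by blast
    then have "card (insert v S) \<le> card (insert D F)"
      using F(2,3) by (simp add: card_insert_if le_SucI card_insert_le_m1)
    moreover have "disjoint (insert D F)"
    proof -
      have "disjnt D C" "disjnt C D" if "C \<in> F" for C
        using F(5) that by (auto simp: disjnt_def)
      then show ?thesis using F(4) by (simp add: pairwise_insert)
    qed
    moreover have "pos_def_on V B (U - insert v S)"
    proof -
      have "pos_def_on V B ((D - {v}) \<union> (U - D - S))"
        by (rule pos_def_on_Un[OF sym _ D(4) F(6)]) (use cut in auto)
      moreover have "U - insert v S = (D - {v}) \<union> (U - D - S)" using D F(1) by auto
      ultimately show ?thesis by simp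
    qed
    ultimately show ?thesis
      using F D by (intro exI[of _ "insert v S"] exI[of _ "insert D F"]) auto
  qed
qed

section \<open>Rayleigh quotients on the span of a flag\<close>

text \<open>The form \<open>ip\<close> is only semidefinite, because it will be a sum over
  \<open>{..<n}\<close> applied to functions on all naturals. \<open>ip_null\<close> takes the place
  of definiteness.\<close>

locale self_adjoint = vector_space scale
  for scale :: "real \<Rightarrow> 'b \<Rightarrow> 'b::ab_group_add" (infixr "*v" 75) +
  fixes ip :: "'b \<Rightarrow> 'b \<Rightarrow> real" and L :: "'b \<Rightarrow> 'b"
  assumes ip_commute: "ip x y = ip y x"
    and ip_add: "ip (x + y) z = ip x z + ip y z"
    and ip_scale: "ip (c *v x) z = c * ip x z"
    and ip_nonneg: "ip x x \<ge> 0"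
    and ip_null: "ip x x = 0 \<Longrightarrow> ip x y = 0"
    and L_add: "L (x + y) = L x + L y"
    and L_scale: "L (c *v x) = c *v L x"
    and L_adjoint: "ip (L x) y = ip x (L y)"
begin

lemma ip_diff: "ip (x - y) z = ip x z - ip y z"
  using ip_add[of "x - y" y z] by simp

lemma ip_add_right: "ip z (x + y) = ip z x + ip z y"
  by (simp add: ip_commute[of z] ip_add)

lemma ip_diff_right: "ip z (x - y) = ip z x - ip z y"
  by (simp add: ip_commute[of z] ip_diff)

lemma ip_scale_right: "ip z (c *v x) = c * ip z x"
  by (simp add: ip_commute[of z] ip_scale)

lemma L_diff: "L (x - y) = L x - L y"
  using L_add[of "x - y" y] by (simp add: algebra_simps)

text \<open>One Gram-Schmidt step per generator: the induction hypothesis is applied to the new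
  generator \<open>a\<close> and to \<open>v\<close>, and the residue of \<open>v\<close> is
  corrected along the residue \<open>b\<close> of \<open>a\<close>.\<close>

lemma orthogonal_projection:
  assumes "finite S"
  shows "\<exists>w\<in>span S. \<forall>z\<in>span S. ip (v - w) z = 0"
  using assms
proof (induction S arbitrary: v rule: finite_induct)
  case empty
  have "ip x 0 = 0" for x
    using ip_add_right[of x 0 0] by simp
  then show ?case by (auto simp: span_empty)
next
  case (insert a S)
  obtain wa where wa: "wa \<in> span S" "\<And>z. z \<in> span S \<Longrightarrow> ip (a - wa) z = 0"
    using insert.IH[of a] by blast
  obtain wv where wv: "wv \<in> span S" "\<And>z. z \<in> span S \<Longrightarrow> ip (v - wv) z = 0"
    using insert.IH[of v] by blast
  define b where "b = a - wa"
  \<comment> \<open>For a null vector \<open>b\<close>, division by zero yields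
    \<open>c = 0\<close>, which is the right value since \<open>b\<close> is then orthogonal to
    everything.\<close>
  define c where "c = ip (v - wv) b / ip b b"
  have mono: "x \<in> span (insert a S)" if "x \<in> span S" for x
    using that span_mono[of S "insert a S"] by blast
  have b: "b \<in> span (insert a S)"
    unfolding b_def by (rule span_diff[OF span_base mono[OF wa(1)]]) simp
  have res: "ip (v - (wv + c *v b)) z = ip (v - wv) z - c * ip b z" for z
    by (simp add: diff_add_eq_diff_diff_swap ip_diff ip_add ip_scale)
  have res_b: "ip (v - (wv + c *v b)) b = 0"
  proof -
    have "ip (v - wv) b = c * ip b b"
      using ip_null[of b "v - wv"] by (cases "ip b b = 0") (simp_all add: c_def ip_commute[of "v - wv" b])
    then show ?thesis unfolding res by simp
  qed
  have "ip (v - (wv + c *v b)) z = 0" if z: "z \<in> span (insert a S)" for z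
  proof -
    obtain k where k: "z - k *v a \<in> span S"
      using z by (auto simp: span_breakdown_eq)
    have "z - k *v b = (z - k *v a) + k *v wa"
      by (simp add: b_def scale_right_diff_distrib)
    also have "\<dots> \<in> span S" using k wa(1) by (intro span_add span_scale)
    finally have s: "z - k *v b \<in> span S" .
    have "ip (v - (wv + c *v b)) (z - k *v b) = 0"
      unfolding res using wv(2)[OF s] wa(2)[OF s] by (simp add: b_def)
    then show ?thesis using res_b by (simp add: ip_diff_right ip_scale_right)
  qed
  moreover have "wv + c *v b \<in> span (insert a S)"
    by (rule span_add[OF mono[OF wv(1)] span_scale[OF b]])
  ultimately show ?case by blast
qed

text \<open>
  The part of \<open>p k\<close> that is orthogonal to the span of the earlier vectors of the flag
  is an eigenvector of \<open>L\<close> up to null vectors.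
\<close>

lemma rayleigh_flag_le:
  fixes p :: "nat \<Rightarrow> 'b"
  assumes "\<And>j. j < k \<Longrightarrow> L (p j) - e j *v p j \<in> span (p ` {..<j})"
    and "\<And>j. j < k \<Longrightarrow> e j \<le> lam"
    and "f \<in> span (p ` {..<k})"
  shows "L f \<in> span (p ` {..<k}) \<and> ip f (L f) \<le> lam * ip f f"
  using assms
proof (induction k arbitrary: f)
  case 0
  have "L 0 = 0" using L_add[of 0 0] by simp
  moreover have "ip 0 0 = 0" using ip_add[of 0 0 0] by simp
  ultimately show ?case using 0 by simp
next
  case (Suc k)
  let ?W = "span (p ` {..<k})"
  have flag: "L (p k) - e k *v p k \<in> ?W" and ek: "e k \<le> lam" using Suc.prems by auto
  have IH: "L g \<in> ?W" "ip g (L g) \<le> lam * ip g g" if "g \<in> ?W" for g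
    using Suc.IH[of g] Suc.prems(1,2) that by auto
  obtain w where w: "w \<in> ?W" "\<And>z. z \<in> ?W \<Longrightarrow> ip (p k - w) z = 0"
    using orthogonal_projection[of "p ` {..<k}" "p k"] by auto
  define u where "u = p k - w"
  have perp: "ip u z = 0" if "z \<in> ?W" for z using w(2)[OF that] by (simp add: u_def)
  define d where "d = L u - e k *v u"
  have "d = (L (p k) - e k *v p k) - (L w - e k *v w)"
    by (simp add: d_def u_def L_diff scale_right_diff_distrib)
  then have d: "d \<in> ?W" using flag IH(1)[OF w(1)] w(1) by (auto intro!: span_diff span_scale)
  \<comment> \<open>Both \<open>d\<close> and \<open>L d\<close> lie in \<open>?W\<close>, to which
    \<open>u\<close> is orthogonal, so moving \<open>L\<close> to the other side shows that
    \<open>d\<close> has norm zero.\<close>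
  have "ip d d = ip (L u) d - e k * ip u d" by (simp add: d_def ip_diff ip_scale)
  also have "\<dots> = 0" using perp[OF d] perp[OF IH(1)[OF d]] by (simp add: L_adjoint)
  finally have d0: "ip d z = 0" for z by (rule ip_null)
  have Lu: "ip z (L u) = e k * ip z u" for z
    using d0[of z] by (simp add: d_def ip_diff ip_scale ip_commute[of z])
  have img: "p ` {..<Suc k} = insert (p k) (p ` {..<k})" by (simp add: lessThan_Suc)
  obtain c where c: "f - c *v p k \<in> ?W"
    using Suc.prems(3) unfolding img by (auto simp: span_breakdown_eq)
  \<comment> \<open>Using \<open>u\<close> instead of \<open>p k\<close> makes the decomposition of
    \<open>f\<close> orthogonal, which removes the mixed terms.\<close>
  define g where "g = f - c *v u"
  have "g = (f - c *v p k) + c *v w" by (simp add: g_def u_def scale_right_diff_distrib)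
  then have g: "g \<in> ?W" using c w(1) by (auto intro!: span_add span_scale)
  have f: "f = g + c *v u" by (simp add: g_def)
  have gu: "ip g u = 0" "ip u g = 0" "ip u (L g) = 0"
    using perp[OF g] perp[OF IH(1)[OF g]] by (auto simp: ip_commute)
  have "ip f (L f) = ip g (L g) + c\<^sup>2 * (e k * ip u u)"
    by (simp add: f L_add L_scale ip_add ip_add_right ip_scale ip_scale_right Lu gu power2_eq_square)
  also have "\<dots> \<le> lam * ip g g + c\<^sup>2 * (lam * ip u u)"
    using IH(2)[OF g] ek ip_nonneg[of u] by (intro add_mono mult_left_mono mult_right_mono) auto
  also have "\<dots> = lam * ip f f"
    by (simp add: f ip_add ip_add_right ip_scale ip_scale_right gu power2_eq_square algebra_simps)
  finally have "ip f (L f) \<le> lam * ip f f" .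
  moreover have "L f \<in> span (p ` {..<Suc k})"
  proof -
    have mono: "?W \<subseteq> span (p ` {..<Suc k})" by (rule span_mono) auto
    have pk: "p k \<in> span (p ` {..<Suc k})" by (rule span_base) auto
    have "L u = d + e k *v (p k - w)" by (simp add: d_def u_def)
    then have "L u \<in> span (p ` {..<Suc k})"
      using d w(1) pk mono by (auto intro!: span_add span_scale span_diff)
    then show ?thesis
      unfolding f L_add L_scale using IH(1)[OF g] mono by (auto intro!: span_add span_scale)
  qed
  ultimately show ?case by blast
qed

end

text \<open>Gaussian elimination: a nonzero entry \<open>u i s\<close> serves as pivot, equation
  \<open>s\<close> is solved for the unknown \<open>i\<close>, and one equation and one unknown
  fewer remain.\<close>

lemma homogeneous_system_nontrivial:
  fixes u :: "'a \<Rightarrow> 'b \<Rightarrow> real"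
  assumes "finite S" "finite J" "card S < card J"
  shows "\<exists>c. (\<exists>j\<in>J. c j \<noteq> 0) \<and> (\<forall>x\<in>S. (\<Sum>j\<in>J. c j * u j x) = 0)"
  using assms
proof (induction S arbitrary: J u rule: finite_induct)
  case empty
  then obtain j where "j \<in> J" by fastforce
  then show ?case by (intro exI[of _ "\<lambda>_. 1"]) auto
next
  case (insert s S)
  show ?case
  proof (cases "\<forall>j\<in>J. u j s = 0")
    case True
    have "card S < card J" using insert by simp
    then obtain c where "\<exists>j\<in>J. c j \<noteq> 0" "\<forall>x\<in>S. (\<Sum>j\<in>J. c j * u j x) = 0"
      using insert.IH[of J u] insert.prems(1) by blast
    then show ?thesis using True by (intro exI[of _ c]) simp
  next
    case False
    then obtain i where i: "i \<in> J" "u i s \<noteq> 0" by blast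
    define v where "v j x = u j x - u j s / u i s * u i x" for j x
    have "card S < card (J - {i})" using insert i by simp
    then obtain c where c: "\<exists>j\<in>J-{i}. c j \<noteq> 0" "\<And>x. x \<in> S \<Longrightarrow> (\<Sum>j\<in>J-{i}. c j * v j x) = 0"
      using insert.IH[of "J - {i}" v] insert.prems by auto
    \<comment> \<open>The value at \<open>i\<close> is dictated by equation \<open>s\<close>;
      substituting it turns the system for \<open>u\<close> into the one for
      \<open>v\<close>.\<close>
    define d where "d j = (if j = i then - (\<Sum>j\<in>J-{i}. c j * u j s / u i s) else c j)" for j
    have eq: "(\<Sum>j\<in>J. d j * u j x) = (\<Sum>j\<in>J-{i}. c j * v j x)" for x
    proof -
      have "(\<Sum>j\<in>J. d j * u j x) = d i * u i x + (\<Sum>j\<in>J-{i}. d j * u j x)"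
        using insert.prems(1) i(1) by (rule sum.remove)
      also have "(\<Sum>j\<in>J-{i}. d j * u j x) = (\<Sum>j\<in>J-{i}. c j * u j x)"
        by (intro sum.cong) (auto simp: d_def)
      also have "d i * u i x = - (\<Sum>j\<in>J-{i}. c j * u j s / u i s * u i x)"
        by (simp add: d_def sum_distrib_right)
      finally show ?thesis
        by (simp add: v_def algebra_simps sum_subtractf)
    qed
    have "(\<Sum>j\<in>J. d j * u j x) = 0" if "x \<in> insert s S" for x
      using that c(2) i(2) unfolding eq by (auto simp: v_def)
    moreover have "\<exists>j\<in>J. d j \<noteq> 0" using c(1) by (auto simp: d_def)
    ultimately show ?thesis by blast
  qed
qed

section \<open>Eigenvalues of weighted symmetric matrices\<close>

text \<open>The Hermitian form \<open>T\<close> of \<open>H\<close> at the eigenvector is real, and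
  the eigenvalue equation multiplied by the weights gives \<open>T = a * N\<close> with a positive
  weighted norm \<open>N\<close>.\<close>

lemma weighted_symmetric_eigenvalue_real:
  fixes H :: "nat \<Rightarrow> nat \<Rightarrow> real" and a :: complex
  assumes sym: "\<And>i j. H i j = H j i" and pos: "\<And>i. i < n \<Longrightarrow> \<mu> i > 0"
    and ev: "eigenvalue (map_mat of_real (mat n n (\<lambda>(i, j). H i j / \<mu> i))) a"
  shows "a \<in> \<real>"
proof -
  let ?A = "map_mat of_real (mat n n (\<lambda>(i, j). H i j / \<mu> i)) :: complex mat"
  obtain v where v: "v \<in> carrier_vec n" "v \<noteq> 0\<^sub>v n" "?A *\<^sub>v v = a \<cdot>\<^sub>v v"
    using ev by (auto simp: eigenvalue_def eigenvector_def)
  have row: "(\<Sum>j<n. of_real (H i j) * v $ j) = a * of_real (\<mu> i) * v $ i" if "i < n" for i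
  proof -
    have "(\<Sum>j<n. of_real (H i j) * v $ j) = of_real (\<mu> i) * (\<Sum>j<n. of_real (H i j / \<mu> i) * v $ j)"
      unfolding sum_distrib_left using pos[OF that] by (intro sum.cong) auto
    also have "(\<Sum>j<n. of_real (H i j / \<mu> i) * v $ j) = (?A *\<^sub>v v) $ i"
      using that v(1) by (simp add: scalar_prod_def lessThan_atLeast0)
    also have "\<dots> = a * v $ i" using that v by simp
    finally show ?thesis by (simp only: ac_simps)
  qed
  define N where "N = (\<Sum>i<n. \<mu> i * (cmod (v $ i))\<^sup>2)"
  define T where "T = (\<Sum>i<n. \<Sum>j<n. cnj (v $ i) * of_real (H i j) * v $ j)"
  have "T = (\<Sum>i<n. cnj (v $ i) * (\<Sum>j<n. of_real (H i j) * v $ j))"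
    by (simp add: T_def sum_distrib_left mult.assoc)
  also have "\<dots> = (\<Sum>i<n. a * of_real (\<mu> i * (cmod (v $ i))\<^sup>2))"
  proof (intro sum.cong refl)
    fix i assume "i \<in> {..<n}"
    then have "cnj (v $ i) * (\<Sum>j<n. of_real (H i j) * v $ j) = cnj (v $ i) * (a * of_real (\<mu> i) * v $ i)"
      by (simp only: row lessThan_iff)
    also have "\<dots> = a * of_real (\<mu> i * (cmod (v $ i))\<^sup>2)"
      by (simp add: complex_norm_square mult_ac flip: of_real_power)
    finally show "cnj (v $ i) * (\<Sum>j<n. of_real (H i j) * v $ j) = a * of_real (\<mu> i * (cmod (v $ i))\<^sup>2)" .
  qed
  finally have T: "T = a * of_real N" by (simp add: N_def sum_distrib_left)
  have "cnj T = (\<Sum>i<n. \<Sum>j<n. cnj (v $ j) * of_real (H j i) * v $ i)"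
    unfolding T_def cnj_sum by (intro sum.cong) (simp_all add: sym mult_ac)
  also have "\<dots> = T" unfolding T_def by (rule sum.swap)
  finally have "cnj a * of_real N = a * of_real N" by (simp add: T)
  moreover have "N > 0"
  proof -
    obtain i where i: "i < n" "v $ i \<noteq> 0" using v by (metis carrier_vecD eq_vecI index_zero_vec)
    have "0 < \<mu> i * (cmod (v $ i))\<^sup>2" using i pos by simp
    also have "\<dots> \<le> N" unfolding N_def
      by (rule member_le_sum) (use i pos in \<open>auto intro!: mult_nonneg_nonneg simp: less_imp_le\<close>)
    finally show ?thesis .
  qed
  ultimately show ?thesis by (simp add: Reals_cnj_iff)
qed

text \<open>Linear factors exist over the complex numbers. Since all roots are real, this
  factorization is the image of a real one under an injective homomorphism.\<close>

lemma weighted_symmetric_char_poly_splits: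
  fixes H :: "nat \<Rightarrow> nat \<Rightarrow> real"
  assumes sym: "\<And>i j. H i j = H j i" and pos: "\<And>i. i < n \<Longrightarrow> \<mu> i > 0"
  shows "\<exists>es. sorted es \<and> length es = n \<and>
           char_poly (mat n n (\<lambda>(i, j). H i j / \<mu> i)) = (\<Prod>e\<leftarrow>es. [:- e, 1:])"
proof -
  let ?A = "mat n n (\<lambda>(i, j). H i j / \<mu> i)"
  let ?C = "map_mat of_real ?A :: complex mat"
  interpret hom: map_poly_inj_idom_hom "of_real :: real \<Rightarrow> complex" ..
  have C: "?C \<in> carrier_mat n n" by simp
  obtain as where as: "char_poly ?C = (\<Prod>a\<leftarrow>as. [:- a, 1:])" "length as = n"
    using char_poly_factorized[OF C] by blast
  have "a \<in> \<real>" if "a \<in> set as" for a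
  proof -
    have "poly (char_poly ?C) a = 0"
      unfolding as(1) poly_prod_list using that by (induction as) auto
    then have ev: "eigenvalue ?C a" using eigenvalue_root_char_poly[OF C] by simp
    show ?thesis
      by (rule weighted_symmetric_eigenvalue_real[of H n \<mu> a]) (use sym pos ev in blast)+
  qed
  then have real: "map of_real (map Re as) = as"
    by (induction as) auto
  define es where "es = sort (map Re as)"
  have "map_poly of_real (char_poly ?A) = (\<Prod>a\<leftarrow>as. [:- a, 1:])"
    by (simp add: of_real_hom.char_poly_hom[symmetric, of ?A n] as(1))
  also have "\<dots> = map_poly of_real (\<Prod>e\<leftarrow>map Re as. [:- e, 1:])"
    by (subst real[symmetric]) (simp add: hom.hom_prod_list o_def)
  finally have "char_poly ?A = (\<Prod>e\<leftarrow>map Re as. [:- e, 1:])" by simp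
  also have "\<dots> = prod_mset (image_mset (\<lambda>e. [:- e, 1:]) (mset (map Re as)))"
    by (simp only: prod_mset_prod_list mset_map[symmetric])
  also have "mset (map Re as) = mset es" by (simp add: es_def)
  also have "prod_mset (image_mset (\<lambda>e. [:- e, 1:]) (mset es)) = (\<Prod>e\<leftarrow>es. [:- e, 1:])"
    by (simp only: prod_mset_prod_list mset_map[symmetric])
  finally show ?thesis using as(2) by (intro exI[of _ es]) (simp add: es_def)
qed

lemma sorted_proots_eq:
  fixes es :: "real list"
  assumes "sorted es"
  shows "sorted_list_of_multiset (proots (\<Prod>e\<leftarrow>es. [:- e, 1:])) = es"
proof -
  have nz: "(\<Prod>e\<leftarrow>es. [:- e, 1:]) \<noteq> 0" for es :: "real list"
    by (auto simp: prod_list_zero_iff)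
  have "proots (\<Prod>e\<leftarrow>es. [:- e, 1:]) = mset es"
  proof (induction es)
    case (Cons e es)
    have "proots (\<Prod>e\<leftarrow>e # es. [:- e, 1:]) = proots [:- e, 1:] + proots (\<Prod>e\<leftarrow>es. [:- e, 1:])"
      using nz[of es] by (simp only: list.map prod_list.Cons) (rule proots_mult, auto)
    then show ?case using Cons by simp
  qed simp
  then show ?thesis using assms by (simp add: sorted_sort_id)
qed

section \<open>The min-max bound\<close>

lemma sum_fun_apply: "(\<Sum>i\<in>I. F i) x = (\<Sum>i\<in>I. F i x)"
  by (induction I rule: infinite_finite_induct) auto

text \<open>A Schur decomposition with diagonal \<open>es\<close> makes the first \<open>k\<close>
  columns of \<open>P\<close> span a space on which the Rayleigh quotient is at most the k-th
  eigenvalue. Vanishing on \<open>S\<close> puts fewer than \<open>k\<close> linear conditions on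
  the \<open>k\<close> coefficients.\<close>

lemma exists_rayleigh_le_vanishing:
  fixes H :: "nat \<Rightarrow> nat \<Rightarrow> real"
  assumes sym: "\<And>i j. H i j = H j i" and pos: "\<And>i. i < n \<Longrightarrow> \<mu> i > 0"
    and es: "sorted es" "length es = n"
      "char_poly (mat n n (\<lambda>(i, j). H i j / \<mu> i)) = (\<Prod>e\<leftarrow>es. [:- e, 1:])"
    and S: "finite S" "card S < k" "k \<le> n"
  shows "\<exists>f. (\<exists>x. f x \<noteq> 0) \<and> (\<forall>x\<ge>n. f x = 0) \<and> (\<forall>x\<in>S. f x = 0) \<and>
           quad_form {..<n} H f \<le> es ! (k - 1) * (\<Sum>x<n. \<mu> x * (f x)\<^sup>2)"
proof -
  let ?A = "mat n n (\<lambda>(i, j). H i j / \<mu> i)"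
  have A: "?A \<in> carrier_mat n n" by simp
  obtain B P Q where dec: "schur_decomposition ?A es = (B, P, Q)"
    by (cases "schur_decomposition ?A es") auto
  have sim: "similar_mat_wit ?A B P Q" and ut: "upper_triangular B" and dg: "diag_mat B = es"
    using schur_decomposition[OF A es(3) dec] by auto
  note wit = similar_mat_witD2[OF A sim]
  have carr: "B \<in> carrier_mat n n" "P \<in> carrier_mat n n" "Q \<in> carrier_mat n n"
    and QP: "Q * P = 1\<^sub>m n" and A_eq: "?A = P * B * Q" using wit by auto
  have AP: "?A * P = P * B"
  proof -
    have "?A * P = P * B * (Q * P)" unfolding A_eq using carr by (simp add: assoc_mult_mat[of _ n n _ n _ n])
    then show ?thesis using carr by (simp add: QP)
  qed
  have Bjj: "B $$ (j, j) = es ! j" if "j < n" for j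
    using that dg carr(1) es(2) unfolding diag_mat_def by auto
  define sc :: "real \<Rightarrow> (nat \<Rightarrow> real) \<Rightarrow> nat \<Rightarrow> real" where "sc c f = (\<lambda>x. c * f x)" for c f
  define ip where "ip f g = (\<Sum>x<n. \<mu> x * f x * g x)" for f g :: "nat \<Rightarrow> real"
  \<comment> \<open>\<open>L f\<close> and the columns \<open>p j\<close> are set to 0 beyond
    \<open>n\<close>, so that identities between columns become identities between
    functions.\<close>
  define L where "L f = (\<lambda>i. if i < n then \<Sum>j<n. H i j / \<mu> i * f j else 0)" for f :: "nat \<Rightarrow> real"
  define p where "p j = (\<lambda>i. if i < n then P $$ (i, j) else 0)" for j
  have \<mu>0: "\<mu> x \<noteq> 0" if "x < n" for x using pos[OF that] by simp
  have ipL: "ip f (L g) = (\<Sum>x<n. \<Sum>y<n. H x y * f x * g y)" for f g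
    unfolding ip_def L_def by (intro sum.cong) (auto simp: sum_distrib_left \<mu>0 mult_ac intro!: sum.cong)
  interpret self_adjoint sc ip L
  proof unfold_locales
    fix f g h :: "nat \<Rightarrow> real" and a b :: real
    show "sc a (f + g) = sc a f + sc a g" "sc (a + b) f = sc a f + sc b f"
      "sc a (sc b f) = sc (a * b) f" "sc 1 f = f"
      by (auto simp: sc_def fun_eq_iff algebra_simps)
    show "ip f g = ip g f" by (simp add: ip_def mult_ac)
    show "ip (f + g) h = ip f h + ip g h" by (simp add: ip_def algebra_simps sum.distrib)
    show "ip (sc a f) g = a * ip f g" by (simp add: ip_def sc_def sum_distrib_left mult_ac)
    have nn: "\<mu> x * f x * f x \<ge> 0" if "x < n" for x
      using pos[OF that] by (simp add: mult.assoc)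
    then show "ip f f \<ge> 0" unfolding ip_def by (intro sum_nonneg) auto
    show "ip f g = 0" if "ip f f = 0"
    proof -
      have "\<mu> x * f x * f x = 0" if "x < n" for x
        using \<open>ip f f = 0\<close> nn that unfolding ip_def by (subst (asm) sum_nonneg_eq_0_iff) auto
      then show ?thesis using pos unfolding ip_def by (intro sum.neutral) force
    qed
    show "L (f + g) = L f + L g" by (auto simp: L_def fun_eq_iff distrib_left sum.distrib)
    show "L (sc a f) = sc a (L f)" by (auto simp: L_def sc_def fun_eq_iff sum_distrib_left mult_ac)
    have "ip (L f) g = ip g (L f)" by (simp add: ip_def mult_ac)
    also have "\<dots> = (\<Sum>x<n. \<Sum>y<n. H y x * f y * g x)"
      unfolding ipL by (intro sum.cong) (simp_all add: sym mult_ac)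
    also have "\<dots> = ip f (L g)" unfolding ipL by (rule sum.swap)
    finally show "ip (L f) g = ip f (L g)" .
  qed
  \<comment> \<open>This is column \<open>j\<close> of \<open>A * P = P * B\<close>: as
    \<open>B\<close> is upper triangular, only earlier columns occur besides the diagonal
    term.\<close>
  have flag: "L (p j) - sc (es ! j) (p j) \<in> span (p ` {..<j})" if j: "j < k" for j
  proof -
    have jn: "j < n" using j S by simp
    have "L (p j) i = (\<Sum>l<j. B $$ (l, j) * p l i) + es ! j * p j i" for i
    proof (cases "i < n")
      case True
      have "L (p j) i = (?A * P) $$ (i, j)"
        using True jn carr by (simp add: L_def p_def scalar_prod_def lessThan_atLeast0)
      also have "\<dots> = (\<Sum>l<n. P $$ (i, l) * B $$ (l, j))"
        unfolding AP using True jn carr by (simp add: scalar_prod_def lessThan_atLeast0)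
      also have "\<dots> = (\<Sum>l<Suc j. P $$ (i, l) * B $$ (l, j))"
        using jn carr ut by (intro sum.mono_neutral_right) (auto intro!: upper_triangularD)
      finally show ?thesis using True jn by (simp add: p_def Bjj mult_ac)
    qed (simp add: L_def p_def)
    then have "L (p j) - sc (es ! j) (p j) = (\<Sum>l<j. sc (B $$ (l, j)) (p l))"
      by (auto simp: fun_eq_iff sum_fun_apply sc_def)
    also have "\<dots> \<in> span (p ` {..<j})"
      by (intro span_sum span_scale span_base) auto
    finally show ?thesis .
  qed
  have "finite {..<k}" "card S < card {..<k}" using S by auto
  then obtain c where c: "\<exists>j<k. c j \<noteq> 0" "\<forall>x\<in>S. (\<Sum>j<k. c j * p j x) = 0"
    using homogeneous_system_nontrivial[OF S(1), of "{..<k}" p] by auto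
  define f where "f = (\<Sum>j<k. sc (c j) (p j))"
  have f: "f x = (\<Sum>j<k. c j * p j x)" for x by (simp add: f_def sum_fun_apply sc_def)
  have "f \<in> span (p ` {..<k})" unfolding f_def by (intro span_sum span_scale span_base) auto
  moreover have "es ! j \<le> es ! (k - 1)" if "j < k" for j
    using that S es by (intro sorted_nth_mono) auto
  ultimately have "ip f (L f) \<le> es ! (k - 1) * ip f f"
    using rayleigh_flag_le[of k p "\<lambda>j. es ! j" "es ! (k - 1)" f] flag by blast
  then have "quad_form {..<n} H f \<le> es ! (k - 1) * (\<Sum>x<n. \<mu> x * (f x)\<^sup>2)"
    by (simp add: ipL quad_form_def) (simp add: ip_def power2_eq_square mult_ac)
  moreover have "\<exists>x. f x \<noteq> 0"
  proof (rule ccontr)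
    assume "\<not> ?thesis"
    then have f0: "(\<Sum>j<k. c j * p j i) = 0" for i using f by simp
    \<comment> \<open>Row \<open>m\<close> of \<open>Q\<close>, the inverse of \<open>P\<close>,
      reads off the coefficient \<open>c m\<close>; a vanishing combination is therefore
      trivial.\<close>
    have "c m = 0" if m: "m < k" for m
    proof -
      have "0 = (\<Sum>i<n. Q $$ (m, i) * (\<Sum>j<k. c j * p j i))" by (simp add: f0)
      also have "\<dots> = (\<Sum>i<n. \<Sum>j<k. c j * (Q $$ (m, i) * p j i))"
        by (simp add: sum_distrib_left mult_ac)
      also have "\<dots> = (\<Sum>j<k. c j * (\<Sum>i<n. Q $$ (m, i) * p j i))"
        by (subst sum.swap) (simp add: sum_distrib_left)
      also have "\<dots> = (\<Sum>j<k. c j * (Q * P) $$ (m, j))"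
        using m S carr by (intro sum.cong) (auto simp: scalar_prod_def p_def lessThan_atLeast0)
      also have "\<dots> = (\<Sum>j<k. if j = m then c j else 0)"
        unfolding QP using m S by (intro sum.cong) auto
      also have "\<dots> = c m" using m by simp
      finally show ?thesis by simp
    qed
    then show False using c(1) by blast
  qed
  moreover have "\<forall>x\<ge>n. f x = 0" by (simp add: f p_def)
  ultimately show ?thesis using c(2) f by (intro exI[of _ f]) simp
qed

section \<open>Level sets and the cut energy\<close>

text \<open>A signed total variation; \<open>fr\<close> marks frustrated pairs. For symmetric
  \<open>W\<close> and the indicator of a set it is the boundary weight plus the weight of the
  frustrated ordered pairs inside, the factor 1/2 compensating for the two orders of a crossing
  pair.\<close>

definition cut_energy ::
    "'a set \<Rightarrow> ('a \<Rightarrow> 'a \<Rightarrow> real) \<Rightarrow> ('a \<Rightarrow> 'a \<Rightarrow> bool) \<Rightarrow> ('a \<Rightarrow> real) \<Rightarrow> real" where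
  "cut_energy V W fr g = (\<Sum>x\<in>V. \<Sum>y\<in>V. W x y *
     (\<bar>g x - g y\<bar> / 2 + (if fr x y then min (g x) (g y) else 0)))"

text \<open>The layer and the remainder are comonotone, and both the absolute difference and the
  minimum are additive on comonotone functions.\<close>

lemma cut_energy_layer:
  assumes U: "U = {x \<in> V. g x > 0}" and t: "\<And>x. x \<in> U \<Longrightarrow> t \<le> g x"
    and nonneg: "\<And>x. x \<in> V \<Longrightarrow> g x \<ge> 0" and "t \<ge> 0"
  shows "cut_energy V W fr g =
    cut_energy V W fr (\<lambda>x. g x - t * of_bool (x \<in> U)) + t * cut_energy V W fr (\<lambda>x. of_bool (x \<in> U))"
proof -
  have zero: "g x = 0" if "x \<in> V" "x \<notin> U" for x
    using that nonneg[of x] U by auto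
  have "\<bar>g x - g y\<bar> = \<bar>(g x - t * of_bool (x \<in> U)) - (g y - t * of_bool (y \<in> U))\<bar>
        + t * \<bar>of_bool (x \<in> U) - of_bool (y \<in> U)\<bar>"
    and "min (g x) (g y) = min (g x - t * of_bool (x \<in> U)) (g y - t * of_bool (y \<in> U))
        + t * min (of_bool (x \<in> U)) (of_bool (y \<in> U))" if "x \<in> V" "y \<in> V" for x y
    using zero[of x] zero[of y] t[of x] t[of y] that \<open>t \<ge> 0\<close>
    by (cases "x \<in> U"; cases "y \<in> U"; simp add: min_def)+
  note eqs = this
  have lin: "w * ((a + t * a') / 2 + (if b then c + t * c' else 0)) =
      w * (a / 2 + (if b then c else 0)) + t * (w * (a' / 2 + (if b then c' else 0)))"
    for w a a' c c' :: real and b by (cases b) (simp_all add: field_simps)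
  show ?thesis
    unfolding cut_energy_def sum_distrib_left sum.distrib[symmetric]
  proof (intro sum.cong refl)
    fix x y assume xy: "x \<in> V" "y \<in> V"
    show "W x y * (\<bar>g x - g y\<bar> / 2 + (if fr x y then min (g x) (g y) else 0)) =
      W x y * (\<bar>g x - t * of_bool (x \<in> U) - (g y - t * of_bool (y \<in> U))\<bar> / 2 +
        (if fr x y then min (g x - t * of_bool (x \<in> U)) (g y - t * of_bool (y \<in> U)) else 0)) +
      t * (W x y * (\<bar>of_bool (x \<in> U) - of_bool (y \<in> U)\<bar> / 2 +
        (if fr x y then min (of_bool (x \<in> U)) (of_bool (y \<in> U)) else 0)))"
      unfolding eqs(1)[OF xy] eqs(2)[OF xy] by (rule lin)
  qed
qed

text \<open>
  A discrete coarea argument: subtracting the smallest positive value from \<open>g\<close> on its support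
  splits both sides additively, so that one of the layers inherits the inequality.
\<close>

lemma cut_energy_level_set:
  assumes "finite V" and "\<And>x. x \<in> V \<Longrightarrow> g x \<ge> 0" and "\<exists>x\<in>V. g x > 0"
    and "cut_energy V W fr g \<le> h * (\<Sum>x\<in>V. m x * g x)"
  shows "\<exists>U. U \<noteq> {} \<and> U \<subseteq> {x \<in> V. g x > 0} \<and>
           cut_energy V W fr (\<lambda>x. of_bool (x \<in> U)) \<le> h * (\<Sum>x\<in>U. m x)"
  using assms(2-)
proof (induction "card {x \<in> V. g x > 0}" arbitrary: g rule: less_induct)
  case less
  define U where "U = {x \<in> V. g x > 0}"
  have U: "finite U" "U \<noteq> {}" "U \<subseteq> V" using assms(1) less.prems(2) by (auto simp: U_def)
  have mU: "(\<Sum>x\<in>V. m x * of_bool (x \<in> U)) = (\<Sum>x\<in>U. m x)"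
  proof -
    have "(\<Sum>x\<in>V. m x * of_bool (x \<in> U)) = (\<Sum>x\<in>U. m x * of_bool (x \<in> U))"
      using U assms(1) by (intro sum.mono_neutral_right) auto
    then show ?thesis by simp
  qed
  show ?case
  proof (cases "cut_energy V W fr (\<lambda>x. of_bool (x \<in> U)) \<le> h * (\<Sum>x\<in>U. m x)")
    case True
    have "U \<subseteq> {x \<in> V. g x > 0}" by (simp add: U_def)
    with True U(2) show ?thesis by (intro exI[of _ U] conjI)
  next
    case False
    \<comment> \<open>With the minimum as height, the layer takes \<open>z\<close> out of the
      support, and the induction on its size can proceed.\<close>
    define t where "t = Min (g ` U)"
    have t: "t \<le> g x" if "x \<in> U" for x using that U by (simp add: t_def)
    have "t \<in> g ` U" unfolding t_def using U by (intro Min_in) auto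
    then obtain z where z: "z \<in> U" "g z = t" by auto
    have t0: "t > 0" using z by (simp add: U_def)
    define g' where "g' x = g x - t * of_bool (x \<in> U)" for x
    have nonneg: "g' x \<ge> 0" if "x \<in> V" for x
      using less.prems(1)[OF that] t[of x] by (simp add: g'_def)
    have "(\<Sum>x\<in>V. m x * g x) = (\<Sum>x\<in>V. m x * g' x) + t * (\<Sum>x\<in>U. m x)"
      unfolding mU[symmetric] sum_distrib_left sum.distrib[symmetric] g'_def
      by (simp add: algebra_simps)
    moreover have "cut_energy V W fr g = cut_energy V W fr g' + t * cut_energy V W fr (\<lambda>x. of_bool (x \<in> U))"
      unfolding g'_def by (rule cut_energy_layer[OF U_def]) (use t t0 less.prems(1) in auto)
    moreover have "t * (h * (\<Sum>x\<in>U. m x)) < t * cut_energy V W fr (\<lambda>x. of_bool (x \<in> U))"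
      using False t0 by (intro mult_strict_left_mono) auto
    ultimately have lt: "cut_energy V W fr g' < h * (\<Sum>x\<in>V. m x * g' x)"
      using less.prems(3) by (simp add: algebra_simps)
    \<comment> \<open>If nothing were left of \<open>g\<close>, the strict inequality
      \<open>lt\<close> would read \<open>0 < 0\<close>.\<close>
    have ex: "\<exists>x\<in>V. g' x > 0"
    proof (rule ccontr)
      assume "\<not> ?thesis"
      then have "g' x = 0" if "x \<in> V" for x using nonneg[OF that] that by force
      then show False using lt by (simp add: cut_energy_def cong: if_cong)
    qed
    have sub: "{x \<in> V. g' x > 0} \<subseteq> U - {z}"
      using z less.prems(1) by (auto simp: g'_def U_def split: if_splits)
    have "card {x \<in> V. g' x > 0} < card U"
      using sub z U by (intro psubset_card_mono) auto
    then have "card {x \<in> V. g' x > 0} < card {x \<in> V. g x > 0}" by (simp only: U_def)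
    then have "\<exists>U'. U' \<noteq> {} \<and> U' \<subseteq> {x \<in> V. g' x > 0} \<and>
        cut_energy V W fr (\<lambda>x. of_bool (x \<in> U')) \<le> h * (\<Sum>x\<in>U'. m x)"
      by (rule less.hyps[OF _ _ ex less_imp_le[OF lt]]) (rule nonneg)
    then obtain U' where U': "U' \<noteq> {}" "U' \<subseteq> {x \<in> V. g' x > 0}"
        "cut_energy V W fr (\<lambda>x. of_bool (x \<in> U')) \<le> h * (\<Sum>x\<in>U'. m x)"
      by (elim exE conjE)
    moreover have "U' \<subseteq> {x \<in> V. g x > 0}"
      using U'(2) sub by (auto simp: U_def)
    ultimately show ?thesis by (intro exI[of _ U'] conjI)
  qed
qed

text \<open>Without frustration \<open>\<bar>a - s * b\<bar>\<close> is the difference of the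
  absolute values and equality holds. With frustration it is their sum, and the left side collapses
  to the mean of the two squares.\<close>

lemma edge_cut_le:
  fixes a b s :: real
  assumes "s = 1 \<or> s = - 1"
  shows "\<bar>a\<^sup>2 - b\<^sup>2\<bar> / 2 + (if s * a * b < 0 then min (a\<^sup>2) (b\<^sup>2) else 0)
           \<le> \<bar>a - s * b\<bar> * (\<bar>a\<bar> + \<bar>b\<bar>) / 2"
proof (cases "s * a * b < 0")
  case False
  have "\<bar>a - s * b\<bar> = \<bar>\<bar>a\<bar> - \<bar>b\<bar>\<bar>"
    using False assms by (auto simp: abs_if zero_le_mult_iff mult_le_0_iff not_less)
  moreover have "\<bar>a\<^sup>2 - b\<^sup>2\<bar> = \<bar>\<bar>a\<bar> - \<bar>b\<bar>\<bar> * (\<bar>a\<bar> + \<bar>b\<bar>)"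
  proof -
    have "a\<^sup>2 - b\<^sup>2 = (\<bar>a\<bar> - \<bar>b\<bar>) * (\<bar>a\<bar> + \<bar>b\<bar>)"
      by (metis power2_abs power2_eq_square square_diff_square_factored mult.commute)
    then show ?thesis by (simp add: abs_mult)
  qed
  ultimately show ?thesis using False by simp
next
  case True
  have "\<bar>a - s * b\<bar> = \<bar>a\<bar> + \<bar>b\<bar>"
    using True assms by (auto simp: abs_if mult_less_0_iff zero_less_mult_iff)
  moreover have "\<bar>a\<^sup>2 - b\<^sup>2\<bar> / 2 + min (a\<^sup>2) (b\<^sup>2) = (a\<^sup>2 + b\<^sup>2) / 2"
    by (simp add: min_def abs_if)
  moreover have "a\<^sup>2 + b\<^sup>2 \<le> (\<bar>a\<bar> + \<bar>b\<bar>) * (\<bar>a\<bar> + \<bar>b\<bar>)"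
    by (simp add: algebra_simps power2_eq_square)
  ultimately show ?thesis using True by simp
qed

text \<open>Cauchy-Schwarz over ordered pairs, with \<open>sqrt (W x y)\<close> in both factors.
  Every edge occurs in two orders, so the first root contains the usual edge energy.\<close>

lemma cut_energy_squares_le:
  fixes W s :: "'a \<Rightarrow> 'a \<Rightarrow> real"
  assumes W: "\<And>x y. W x y \<ge> 0" "\<And>x y. W x y = W y x"
    and s: "\<And>x y. W x y \<noteq> 0 \<Longrightarrow> s x y = 1 \<or> s x y = - 1"
  shows "cut_energy V W (\<lambda>x y. s x y * f x * f y < 0) (\<lambda>x. (f x)\<^sup>2) \<le>
    sqrt ((\<Sum>x\<in>V. \<Sum>y\<in>V. W x y * (f x - s x y * f y)\<^sup>2) / 2) * sqrt (2 * (\<Sum>x\<in>V. (\<Sum>y\<in>V. W x y) * (f x)\<^sup>2))"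
proof -
  define a where "a = (\<lambda>(x, y). sqrt (W x y) * (f x - s x y * f y))"
  define b where "b = (\<lambda>(x, y). sqrt (W x y) * (\<bar>f x\<bar> + \<bar>f y\<bar>))"
  have "cut_energy V W (\<lambda>x y. s x y * f x * f y < 0) (\<lambda>x. (f x)\<^sup>2) \<le>
     (\<Sum>x\<in>V. \<Sum>y\<in>V. W x y * (\<bar>f x - s x y * f y\<bar> * (\<bar>f x\<bar> + \<bar>f y\<bar>) / 2))"
    unfolding cut_energy_def
  proof (intro sum_mono)
    fix x y
    show "W x y * (\<bar>(f x)\<^sup>2 - (f y)\<^sup>2\<bar> / 2 + (if s x y * f x * f y < 0 then min ((f x)\<^sup>2) ((f y)\<^sup>2) else 0))
      \<le> W x y * (\<bar>f x - s x y * f y\<bar> * (\<bar>f x\<bar> + \<bar>f y\<bar>) / 2)"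
      using edge_cut_le[OF s, of x y "f x" "f y"] W(1)[of x y]
      by (cases "W x y = 0") (auto intro: mult_left_mono)
  qed
  also have "\<dots> = (\<Sum>e\<in>V\<times>V. \<bar>a e\<bar> * \<bar>b e\<bar>) / 2"
  proof -
    have "W x y * (\<bar>f x - s x y * f y\<bar> * (\<bar>f x\<bar> + \<bar>f y\<bar>) / 2) = \<bar>a (x, y)\<bar> * \<bar>b (x, y)\<bar> / 2" for x y
    proof -
      have "W x y = sqrt (W x y) * sqrt (W x y)" using W(1) by simp
      then show ?thesis using W(1)[of x y] by (simp add: a_def b_def abs_mult)
    qed
    then show ?thesis by (simp add: sum.cartesian_product sum_divide_distrib case_prod_unfold)
  qed
  also have "\<dots> \<le> L2_set a (V\<times>V) * L2_set b (V\<times>V) / 2"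
    using L2_set_mult_ineq[of a b "V\<times>V"] by simp
  also have "L2_set a (V\<times>V) = sqrt (\<Sum>x\<in>V. \<Sum>y\<in>V. W x y * (f x - s x y * f y)\<^sup>2)"
    using W(1) by (simp add: L2_set_def a_def sum.cartesian_product case_prod_unfold power_mult_distrib)
  also have "L2_set b (V\<times>V) = sqrt (\<Sum>x\<in>V. \<Sum>y\<in>V. W x y * (\<bar>f x\<bar> + \<bar>f y\<bar>)\<^sup>2)"
    using W(1) by (simp add: L2_set_def b_def sum.cartesian_product case_prod_unfold power_mult_distrib)
  finally have cut: "cut_energy V W (\<lambda>x y. s x y * f x * f y < 0) (\<lambda>x. (f x)\<^sup>2) \<le>
    sqrt (\<Sum>x\<in>V. \<Sum>y\<in>V. W x y * (f x - s x y * f y)\<^sup>2) *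
    sqrt (\<Sum>x\<in>V. \<Sum>y\<in>V. W x y * (\<bar>f x\<bar> + \<bar>f y\<bar>)\<^sup>2) / 2" (is "_ \<le> sqrt ?X * sqrt ?Y / 2") .
  \<comment> \<open>One factor 2 comes from the square of a sum, the other from the symmetry of
    \<open>W\<close>, by which both ends contribute equally.\<close>
  have "?Y \<le> 4 * (\<Sum>x\<in>V. (\<Sum>y\<in>V. W x y) * (f x)\<^sup>2)" (is "_ \<le> 4 * ?Z")
  proof -
    have "(\<bar>f x\<bar> + \<bar>f y\<bar>)\<^sup>2 \<le> 2 * (f x)\<^sup>2 + 2 * (f y)\<^sup>2" for x y
      using sum_squares_bound[of "\<bar>f x\<bar>" "\<bar>f y\<bar>"] by (simp add: power2_sum)
    then have "(\<Sum>x\<in>V. \<Sum>y\<in>V. W x y * (\<bar>f x\<bar> + \<bar>f y\<bar>)\<^sup>2) \<le>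
        (\<Sum>x\<in>V. \<Sum>y\<in>V. W x y * (2 * (f x)\<^sup>2 + 2 * (f y)\<^sup>2))"
      by (intro sum_mono mult_left_mono W(1))
    also have "\<dots> = 2 * (\<Sum>x\<in>V. \<Sum>y\<in>V. W x y * (f x)\<^sup>2) + 2 * (\<Sum>x\<in>V. \<Sum>y\<in>V. W x y * (f y)\<^sup>2)"
      by (simp add: algebra_simps sum.distrib sum_distrib_left)
    also have "(\<Sum>x\<in>V. \<Sum>y\<in>V. W x y * (f y)\<^sup>2) = (\<Sum>x\<in>V. \<Sum>y\<in>V. W x y * (f x)\<^sup>2)"
      by (subst sum.swap) (simp add: W(2))
    finally show ?thesis by (simp add: sum_distrib_right)
  qed
  then have "sqrt ?X * sqrt ?Y / 2 \<le> sqrt ?X * sqrt (4 * ?Z) / 2"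
    using W(1) by (intro divide_right_mono mult_left_mono real_sqrt_le_mono) (auto intro!: sum_nonneg)
  also have "\<dots> = sqrt (?X / 2) * sqrt (2 * ?Z)"
    by (simp add: real_sqrt_mult real_sqrt_divide)
  finally show ?thesis using cut by linarith
qed

section \<open>The signed Cheeger inequality\<close>

definition edge_weight :: "signed_graph \<Rightarrow> nat \<Rightarrow> nat \<Rightarrow> real" where
  "edge_weight \<Gamma> x y = (if adj \<Gamma> x y then weight \<Gamma> {x, y} else 0)"

text \<open>The entries of D - A^sigma + K. The inverse of M is left out to keep the matrix
  symmetric; the measure reappears as the weight of the inner product.\<close>

definition laplacian_entry :: "signed_graph \<Rightarrow> nat \<Rightarrow> nat \<Rightarrow> real" where
  "laplacian_entry \<Gamma> x y =
     (if x = y then wdegree \<Gamma> x + potential \<Gamma> x else 0) - edge_sign \<Gamma> {x, y} * edge_weight \<Gamma> x y"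

lemma finite_verts [simp]: "finite (verts \<Gamma>)"
  by (simp add: verts_def)

lemma adj_commute: "adj \<Gamma> x y \<longleftrightarrow> adj \<Gamma> y x"
  by (simp add: adj_def insert_commute)

lemma edge_weight_commute: "edge_weight \<Gamma> x y = edge_weight \<Gamma> y x"
  by (simp add: edge_weight_def adj_commute[of \<Gamma> x] insert_commute)

lemma laplacian_entry_commute: "laplacian_entry \<Gamma> x y = laplacian_entry \<Gamma> y x"
  by (auto simp: laplacian_entry_def edge_weight_commute[of \<Gamma> x] insert_commute)

lemma wdegree_eq: "wdegree \<Gamma> x = (\<Sum>y\<in>verts \<Gamma>. edge_weight \<Gamma> x y)"
  by (simp add: wdegree_def edge_weight_def sum.inter_filter)

lemma normalized_laplacian_eq:
  "normalized_laplacian \<Gamma> =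
     mat (nverts \<Gamma>) (nverts \<Gamma>) (\<lambda>(i, j). laplacian_entry \<Gamma> i j / vmeasure \<Gamma> i)"
proof -
  have "mat_diag (nverts \<Gamma>) (wdegree \<Gamma>) - signed_adjacency \<Gamma> + mat_diag (nverts \<Gamma>) (potential \<Gamma>)
      = mat (nverts \<Gamma>) (nverts \<Gamma>) (\<lambda>(i, j). laplacian_entry \<Gamma> i j)"
    by (rule eq_matI) (auto simp: mat_diag_def signed_adjacency_def laplacian_entry_def edge_weight_def)
  then show ?thesis
    unfolding normalized_laplacian_def
    by (subst mat_diag_mult_left[of _ _ "nverts \<Gamma>"]) (auto intro!: eq_matI)
qed

text \<open>With full double sums against one kernel, the numerator of \<open>beta\<close> and the
  cut energy can be compared one ordered pair at a time.\<close>

lemma signed_edges_eq: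
  assumes "A \<subseteq> verts \<Gamma>" "B \<subseteq> verts \<Gamma>"
  shows "signed_edges s \<Gamma> A B =
    (\<Sum>x\<in>verts \<Gamma>. \<Sum>y\<in>verts \<Gamma>. edge_weight \<Gamma> x y * of_bool (x \<in> A \<and> y \<in> B \<and> edge_sign \<Gamma> {x, y} = s))"
proof -
  have "signed_edges s \<Gamma> A B =
      (\<Sum>x\<in>A. \<Sum>y\<in>verts \<Gamma>. edge_weight \<Gamma> x y * of_bool (x \<in> A \<and> y \<in> B \<and> edge_sign \<Gamma> {x, y} = s))"
    unfolding signed_edges_def
  proof (rule sum.cong[OF refl])
    fix x assume "x \<in> A"
    then show "(\<Sum>y | y \<in> B \<and> adj \<Gamma> x y \<and> edge_sign \<Gamma> {x, y} = s. weight \<Gamma> {x, y}) =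
      (\<Sum>y\<in>verts \<Gamma>. edge_weight \<Gamma> x y * of_bool (x \<in> A \<and> y \<in> B \<and> edge_sign \<Gamma> {x, y} = s))"
      using assms by (intro sum.mono_neutral_cong_left) (auto simp: edge_weight_def)
  qed
  also have "\<dots> = (\<Sum>x\<in>verts \<Gamma>. \<Sum>y\<in>verts \<Gamma>. edge_weight \<Gamma> x y * of_bool (x \<in> A \<and> y \<in> B \<and> edge_sign \<Gamma> {x, y} = s))"
    using assms by (intro sum.mono_neutral_left) auto
  finally show ?thesis .
qed

lemma boundary_weight_eq:
  assumes "A \<subseteq> verts \<Gamma>"
  shows "boundary_weight \<Gamma> A =
    (\<Sum>x\<in>verts \<Gamma>. \<Sum>y\<in>verts \<Gamma>. edge_weight \<Gamma> x y * of_bool (x \<in> A \<and> y \<notin> A))"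
proof -
  have "boundary_weight \<Gamma> A = (\<Sum>x\<in>A. \<Sum>y\<in>verts \<Gamma>. edge_weight \<Gamma> x y * of_bool (x \<in> A \<and> y \<notin> A))"
    unfolding boundary_weight_def
  proof (rule sum.cong[OF refl])
    fix x assume "x \<in> A"
    then show "(\<Sum>y | y \<in> verts \<Gamma> - A \<and> adj \<Gamma> x y. weight \<Gamma> {x, y}) =
      (\<Sum>y\<in>verts \<Gamma>. edge_weight \<Gamma> x y * of_bool (x \<in> A \<and> y \<notin> A))"
      by (intro sum.mono_neutral_cong_left) (auto simp: edge_weight_def)
  qed
  also have "\<dots> = (\<Sum>x\<in>verts \<Gamma>. \<Sum>y\<in>verts \<Gamma>. edge_weight \<Gamma> x y * of_bool (x \<in> A \<and> y \<notin> A))"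
    using assms by (intro sum.mono_neutral_left) auto
  finally show ?thesis .
qed

section \<open>Energy and cuts of a well-formed signed graph\<close>

context
  fixes \<Gamma> :: signed_graph
  assumes wf: "wf_signed_graph \<Gamma>"
begin

lemma adj_verts: "adj \<Gamma> x y \<Longrightarrow> x \<in> verts \<Gamma>" "adj \<Gamma> x y \<Longrightarrow> y \<in> verts \<Gamma>"
  using wf by (auto simp: wf_signed_graph_def adj_def)

lemma edge_weight_nonneg: "edge_weight \<Gamma> x y \<ge> 0"
  using wf by (auto simp: wf_signed_graph_def adj_def edge_weight_def less_imp_le)

lemma edge_sign_cases:
  "edge_weight \<Gamma> x y \<noteq> 0 \<Longrightarrow> edge_sign \<Gamma> {x, y} = 1 \<or> edge_sign \<Gamma> {x, y} = - 1"
  using wf by (auto simp: wf_signed_graph_def adj_def edge_weight_def split: if_splits)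

lemma vmeasure_pos: "x \<in> verts \<Gamma> \<Longrightarrow> vmeasure \<Gamma> x > 0"
  using wf by (simp add: wf_signed_graph_def)

text \<open>Signs square to 1, so over all ordered pairs the pure squares add up to twice the degree
  form and the mixed terms to twice the adjacency form; hence the division by 2.\<close>

lemma quad_form_laplacian:
  "quad_form (verts \<Gamma>) (laplacian_entry \<Gamma>) f =
     (\<Sum>x\<in>verts \<Gamma>. \<Sum>y\<in>verts \<Gamma>. edge_weight \<Gamma> x y * (f x - edge_sign \<Gamma> {x, y} * f y)\<^sup>2) / 2
     + (\<Sum>x\<in>verts \<Gamma>. potential \<Gamma> x * (f x)\<^sup>2)"
proof -
  let ?V = "verts \<Gamma>" and ?W = "edge_weight \<Gamma>" and ?s = "\<lambda>x y. edge_sign \<Gamma> {x, y}"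
  have "?W x y * (f x - ?s x y * f y)\<^sup>2 = ?W x y * (f x)\<^sup>2 + ?W x y * (f y)\<^sup>2 - 2 * (?s x y * ?W x y * f x * f y)" for x y
    using edge_sign_cases[of x y] by (cases "?W x y = 0") (auto simp: power2_eq_square algebra_simps)
  then have "(\<Sum>x\<in>?V. \<Sum>y\<in>?V. ?W x y * (f x - ?s x y * f y)\<^sup>2) =
      (\<Sum>x\<in>?V. \<Sum>y\<in>?V. ?W x y * (f x)\<^sup>2) + (\<Sum>x\<in>?V. \<Sum>y\<in>?V. ?W x y * (f y)\<^sup>2)
      - 2 * (\<Sum>x\<in>?V. \<Sum>y\<in>?V. ?s x y * ?W x y * f x * f y)"
    by (simp add: sum.distrib sum_subtractf sum_distrib_left)
  moreover have "(\<Sum>x\<in>?V. \<Sum>y\<in>?V. ?W x y * (f y)\<^sup>2) = (\<Sum>x\<in>?V. \<Sum>y\<in>?V. ?W x y * (f x)\<^sup>2)"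
    by (subst sum.swap) (simp add: edge_weight_commute)
  moreover have "(\<Sum>x\<in>?V. \<Sum>y\<in>?V. ?W x y * (f x)\<^sup>2) = (\<Sum>x\<in>?V. wdegree \<Gamma> x * (f x)\<^sup>2)"
    by (simp add: wdegree_eq sum_distrib_right)
  moreover have "quad_form ?V (laplacian_entry \<Gamma>) f =
      (\<Sum>x\<in>?V. (wdegree \<Gamma> x + potential \<Gamma> x) * (f x)\<^sup>2) - (\<Sum>x\<in>?V. \<Sum>y\<in>?V. ?s x y * ?W x y * f x * f y)"
  proof -
    have "(\<Sum>y\<in>?V. laplacian_entry \<Gamma> x y * f x * f y) =
      (wdegree \<Gamma> x + potential \<Gamma> x) * (f x)\<^sup>2 - (\<Sum>y\<in>?V. ?s x y * ?W x y * f x * f y)" if "x \<in> ?V" for x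
    proof -
      have "(\<Sum>y\<in>?V. laplacian_entry \<Gamma> x y * f x * f y) =
          (\<Sum>y\<in>?V. (if x = y then (wdegree \<Gamma> x + potential \<Gamma> x) * (f x)\<^sup>2 else 0) - ?s x y * ?W x y * f x * f y)"
        by (intro sum.cong) (auto simp: laplacian_entry_def algebra_simps power2_eq_square)
      then show ?thesis using that by (simp add: sum_subtractf)
    qed
    then show ?thesis by (simp add: quad_form_def sum_subtractf)
  qed
  ultimately show ?thesis by (simp add: algebra_simps sum.distrib)
qed

lemma wdegree_le_tau:
  assumes "x \<in> verts \<Gamma>"
  shows "wdegree \<Gamma> x \<le> tau \<Gamma> * vmeasure \<Gamma> x"
proof -
  have "wdegree \<Gamma> x / vmeasure \<Gamma> x \<le> tau \<Gamma>"
    unfolding tau_def using assms by (intro Max_ge) auto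
  then show ?thesis using vmeasure_pos[OF assms] by (simp add: pos_divide_le_eq)
qed

text \<open>A pair inside \<open>U\<close> is frustrated exactly when a positive edge joins
  \<open>A\<close> to \<open>B\<close> or a negative edge stays within one of them.\<close>

lemma beta_numerator_eq:
  assumes U: "U \<subseteq> verts \<Gamma>" and nz: "\<And>x. x \<in> U \<Longrightarrow> f x \<noteq> 0"
  defines "A \<equiv> {x \<in> U. f x > 0}" and "B \<equiv> {x \<in> U. f x < (0 :: real)}"
  shows "2 * signed_edges 1 \<Gamma> A B + signed_edges (-1) \<Gamma> A A + signed_edges (-1) \<Gamma> B B
      + boundary_weight \<Gamma> U =
    cut_energy (verts \<Gamma>) (edge_weight \<Gamma>) (\<lambda>x y. edge_sign \<Gamma> {x, y} * f x * f y < 0) (\<lambda>x. of_bool (x \<in> U))"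
proof -
  let ?V = "verts \<Gamma>" and ?W = "edge_weight \<Gamma>" and ?s = "\<lambda>x y. edge_sign \<Gamma> {x, y}"
  let ?I = "\<lambda>X Y t x y. of_bool (x \<in> X \<and> y \<in> Y \<and> ?s x y = t) :: real"
  let ?b = "\<lambda>x y. of_bool (x \<in> U \<and> y \<notin> U) :: real"
  have AB: "A \<subseteq> ?V" "B \<subseteq> ?V" using U by (auto simp: A_def B_def)
  have swap: "(\<Sum>x\<in>?V. \<Sum>y\<in>?V. ?W x y * F x y) = (\<Sum>x\<in>?V. \<Sum>y\<in>?V. ?W x y * F y x)" for F
    by (subst sum.swap) (simp add: edge_weight_commute)
  have "?I A B 1 y x = ?I B A 1 x y" for x y by (auto simp: insert_commute)
  then have E: "2 * signed_edges 1 \<Gamma> A B =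
      (\<Sum>x\<in>?V. \<Sum>y\<in>?V. ?W x y * ?I A B 1 x y) + (\<Sum>x\<in>?V. \<Sum>y\<in>?V. ?W x y * ?I B A 1 x y)"
    unfolding signed_edges_eq[OF AB] using swap[of "?I A B 1"] by simp
  \<comment> \<open>The boundary weight counts a crossing edge in one order only; it is spread
    evenly over both to match the halved absolute difference.\<close>
  have bd: "boundary_weight \<Gamma> U = (\<Sum>x\<in>?V. \<Sum>y\<in>?V. ?W x y * (?b x y / 2)) + (\<Sum>x\<in>?V. \<Sum>y\<in>?V. ?W x y * (?b y x / 2))"
    unfolding boundary_weight_eq[OF U] using swap[of "\<lambda>x y. ?b x y / 2"]
    by (simp flip: sum_divide_distrib)
  have "?W x y * (\<bar>of_bool (x \<in> U) - of_bool (y \<in> U)\<bar> / 2 +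
        (if ?s x y * f x * f y < 0 then min (of_bool (x \<in> U)) (of_bool (y \<in> U)) else 0)) =
      ?W x y * ?I A B 1 x y + ?W x y * ?I B A 1 x y + ?W x y * ?I A A (-1) x y + ?W x y * ?I B B (-1) x y
      + (?W x y * (?b x y / 2) + ?W x y * (?b y x / 2))" for x y
  proof (cases "?W x y = 0")
    case False
    then have s: "?s x y = 1 \<or> ?s x y = -1" by (rule edge_sign_cases)
    have "\<bar>of_bool (x \<in> U) - of_bool (y \<in> U)\<bar> / 2 +
        (if ?s x y * f x * f y < 0 then min (of_bool (x \<in> U)) (of_bool (y \<in> U)) else 0) =
        ?I A B 1 x y + ?I B A 1 x y + ?I A A (-1) x y + ?I B B (-1) x y + (?b x y / 2 + ?b y x / 2)"
    proof (cases "x \<in> U \<and> y \<in> U")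
      case True
      with nz have "f x < 0 \<or> f x > 0" "f y < 0 \<or> f y > 0" by (meson linorder_neqE)+
      with s True show ?thesis
        by (elim disjE) (simp_all add: A_def B_def mult_less_0_iff zero_less_mult_iff)
    next
      case False
      then show ?thesis by (auto simp: A_def B_def)
    qed
    then show ?thesis by (simp add: distrib_left)
  qed simp
  then show ?thesis
    unfolding cut_energy_def E bd signed_edges_eq[OF AB(1) AB(1)] signed_edges_eq[OF AB(2) AB(2)]
    by (simp only: sum.distrib)
qed

text \<open>The coarea argument for the square of \<open>f\<close> yields a set inside the support
  of \<open>f\<close>, hence inside \<open>C\<close>; the sign of \<open>f\<close> splits it into
  \<open>A\<close> and \<open>B\<close>.\<close>

lemma cheeger_cut:
  assumes pot: "\<And>x. x \<in> verts \<Gamma> \<Longrightarrow> potential \<Gamma> x \<ge> 0"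
    and C: "C \<subseteq> verts \<Gamma>" "\<And>x. x \<notin> C \<Longrightarrow> f x = 0" and nz: "\<exists>x. f x \<noteq> 0"
    and rayleigh: "quad_form (verts \<Gamma>) (laplacian_entry \<Gamma>) f \<le> l * (\<Sum>x\<in>verts \<Gamma>. vmeasure \<Gamma> x * (f x)\<^sup>2)"
  shows "\<exists>A B. A \<inter> B = {} \<and> A \<union> B \<noteq> {} \<and> A \<union> B \<subseteq> C \<and> beta \<Gamma> A B \<le> sqrt (2 * tau \<Gamma> * l)"
proof -
  let ?V = "verts \<Gamma>" and ?W = "edge_weight \<Gamma>" and ?s = "\<lambda>x y. edge_sign \<Gamma> {x, y}"
  let ?fr = "\<lambda>x y. ?s x y * f x * f y < 0" and ?h = "sqrt (2 * tau \<Gamma> * l)"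
  define N where "N = (\<Sum>x\<in>?V. vmeasure \<Gamma> x * (f x)\<^sup>2)"
  define E where "E = (\<Sum>x\<in>?V. \<Sum>y\<in>?V. ?W x y * (f x - ?s x y * f y)\<^sup>2) / 2"
  have N0: "N \<ge> 0" unfolding N_def using vmeasure_pos by (intro sum_nonneg) (simp add: less_imp_le)
  have "(\<Sum>x\<in>?V. potential \<Gamma> x * (f x)\<^sup>2) \<ge> 0" using pot by (intro sum_nonneg) simp
  \<comment> \<open>Dropping the nonnegative potential term leaves the edge energy alone. Together
    with \<open>E \<ge> 0\<close> this also settles the sign of \<open>l * N\<close>.\<close>
  then have E: "E \<le> l * N" using rayleigh unfolding quad_form_laplacian E_def N_def by linarith
  have E0: "E \<ge> 0" unfolding E_def using edge_weight_nonneg by (simp add: sum_nonneg)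
  have D: "(\<Sum>x\<in>?V. (\<Sum>y\<in>?V. ?W x y) * (f x)\<^sup>2) \<le> tau \<Gamma> * N"
    unfolding N_def sum_distrib_left wdegree_eq[symmetric] mult.assoc[symmetric]
    using wdegree_le_tau by (intro sum_mono mult_right_mono) auto
  have "cut_energy ?V ?W ?fr (\<lambda>x. (f x)\<^sup>2) \<le> sqrt E * sqrt (2 * (\<Sum>x\<in>?V. (\<Sum>y\<in>?V. ?W x y) * (f x)\<^sup>2))"
    unfolding E_def
    by (rule cut_energy_squares_le) (auto simp: edge_weight_nonneg edge_weight_commute dest: edge_sign_cases)
  also have "\<dots> \<le> sqrt (l * N) * sqrt (2 * (tau \<Gamma> * N))"
    using E E0 D edge_weight_nonneg by (intro mult_mono real_sqrt_le_mono) (auto intro!: sum_nonneg mult_nonneg_nonneg)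
  also have "\<dots> = sqrt ((2 * tau \<Gamma> * l) * N\<^sup>2)"
    by (simp add: power2_eq_square ac_simps flip: real_sqrt_mult)
  also have "\<dots> = ?h * N"
    using N0 by (simp add: real_sqrt_mult)
  finally have "cut_energy ?V ?W ?fr (\<lambda>x. (f x)\<^sup>2) \<le> ?h * (\<Sum>x\<in>?V. vmeasure \<Gamma> x * (f x)\<^sup>2)"
    by (simp add: N_def)
  moreover have "\<exists>x\<in>?V. (f x)\<^sup>2 > 0" using nz C by fastforce
  ultimately obtain U where U: "U \<noteq> {}" "U \<subseteq> {x \<in> ?V. (f x)\<^sup>2 > 0}"
    and cut: "cut_energy ?V ?W ?fr (\<lambda>x. of_bool (x \<in> U)) \<le> ?h * (\<Sum>x\<in>U. vmeasure \<Gamma> x)"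
    using cut_energy_level_set[of ?V "\<lambda>x. (f x)\<^sup>2" ?W ?fr ?h "vmeasure \<Gamma>"] by auto
  define A where "A = {x \<in> U. f x > 0}"
  define B where "B = {x \<in> U. f x < 0}"
  have UV: "U \<subseteq> ?V" using U(2) by auto
  have Unz: "f x \<noteq> 0" if "x \<in> U" for x using U(2) that by auto
  have AB: "A \<union> B = U" using Unz by (force simp: A_def B_def)
  have "(\<Sum>x\<in>U. vmeasure \<Gamma> x) > 0"
    using U UV vmeasure_pos by (intro sum_pos) (auto intro: finite_subset)
  then have "beta \<Gamma> A B \<le> ?h"
    using cut beta_numerator_eq[of U f] UV Unz unfolding beta_def AB
    by (simp add: A_def B_def pos_divide_le_eq)
  moreover have "A \<inter> B = {}" by (auto simp: A_def B_def)
  moreover have "U \<subseteq> C" using Unz C(2) by blast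
  ultimately show ?thesis using AB U(1) by (intro exI[of _ A] exI[of _ B]) simp
qed

end

section \<open>Feedback vertex sets and sub-bipartitions\<close>

lemma connected_rank:
  assumes wf: "wf_signed_graph \<Gamma>" and conn: "connected_graph \<Gamma>"
  obtains root and r :: "nat \<Rightarrow> nat" where "root \<in> verts \<Gamma>" "inj_on r (verts \<Gamma>)"
    "\<And>x. \<lbrakk>x \<in> verts \<Gamma>; x \<noteq> root\<rbrakk> \<Longrightarrow> \<exists>y. adj \<Gamma> x y \<and> r y < r x"
    "\<And>y. y \<in> verts \<Gamma> \<Longrightarrow> r root \<le> r y"
proof -
  obtain root where root: "root \<in> verts \<Gamma>"
    and reach: "\<And>x. x \<in> verts \<Gamma> \<Longrightarrow> (adj \<Gamma>)\<^sup>*\<^sup>* root x"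
    using conn by (auto simp: connected_graph_def)
  define d where "d x = (LEAST i. (adj \<Gamma> ^^ i) root x)" for x
  \<comment> \<open>Distance from the root first, vertex number second: the remainder modulo
    \<open>nverts \<Gamma>\<close> returns the vertex, and a step towards the root outweighs any
    change of number.\<close>
  define r where "r x = d x * nverts \<Gamma> + x" for x
  have d: "(adj \<Gamma> ^^ d x) root x" if x: "x \<in> verts \<Gamma>" for x
  proof -
    obtain i where "(adj \<Gamma> ^^ i) root x"
      using rtranclp_imp_relpowp[OF reach[OF x]] by blast
    then show ?thesis unfolding d_def by (rule LeastI)
  qed
  have d_le: "d x \<le> i" if "(adj \<Gamma> ^^ i) root x" for x i
    unfolding d_def using that by (rule Least_le)
  have lt: "x < nverts \<Gamma>" if "x \<in> verts \<Gamma>" for x using that by (simp add: verts_def)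
  have "r x mod nverts \<Gamma> = x" if "x \<in> verts \<Gamma>" for x
    using lt[OF that] by (simp add: r_def)
  then have inj: "inj_on r (verts \<Gamma>)" by (metis inj_onI)
  have d_root: "d root = 0" using d_le[of 0 root] by simp
  have parent: "\<exists>y. adj \<Gamma> x y \<and> r y < r x" if x: "x \<in> verts \<Gamma>" "x \<noteq> root" for x
  proof -
    have "d x \<noteq> 0" using d[OF x(1)] x(2) by (auto intro: ccontr)
    then obtain i where i: "d x = Suc i" by (cases "d x") auto
    with d[OF x(1)] obtain y where y: "(adj \<Gamma> ^^ i) root y" "adj \<Gamma> y x"
      by (auto elim: relpowp_Suc_E)
    have "r y < nverts \<Gamma> * Suc (d y)"
      using lt[OF adj_verts(1)[OF wf y(2)]] by (simp add: r_def)
    also have "\<dots> \<le> nverts \<Gamma> * d x"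
      using d_le[OF y(1)] unfolding i by (intro mult_le_mono2) simp
    also have "\<dots> \<le> r x" by (simp add: r_def)
    finally show ?thesis using y(2) adj_commute by blast
  qed
  have "r root \<le> r y" if y: "y \<in> verts \<Gamma>" for y
  proof (cases "d y = 0")
    case True
    then show ?thesis using d[OF y] by simp
  next
    case False
    then have "r root \<le> d y * nverts \<Gamma>" using lt[OF root] by (cases "d y") (auto simp: r_def d_root)
    then show ?thesis by (simp add: r_def)
  qed
  then show thesis using that[OF root inj] parent by blast
qed

text \<open>Edges are counted at their end of larger rank. Every vertex but the root has a lower
  neighbour and those in \<open>R\<close> have at least two, so |V| - 1 + |R| \<le> |E|. Outside
  \<open>R\<close> the lower neighbour is unique, as a forest order demands.\<close>

lemma feedback_vertex_set:
  assumes wf: "wf_signed_graph \<Gamma>" and conn: "connected_graph \<Gamma>"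
  obtains R and r :: "nat \<Rightarrow> nat" where "R \<subseteq> verts \<Gamma>" "int (card R) \<le> cyclomatic \<Gamma>"
    "inj_on r (verts \<Gamma>)"
    "\<And>x y z. \<lbrakk>x \<in> verts \<Gamma> - R; adj \<Gamma> x y; adj \<Gamma> x z; r y < r x; r z < r x\<rbrakk> \<Longrightarrow> y = z"
proof -
  let ?V = "verts \<Gamma>"
  obtain root and r :: "nat \<Rightarrow> nat" where root: "root \<in> ?V" and inj: "inj_on r ?V"
    and parent: "\<And>x. \<lbrakk>x \<in> ?V; x \<noteq> root\<rbrakk> \<Longrightarrow> \<exists>y. adj \<Gamma> x y \<and> r y < r x"
    and root_le: "\<And>y. y \<in> ?V \<Longrightarrow> r root \<le> r y"
    using connected_rank[OF wf conn] by metis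
  define low where "low x = {y. adj \<Gamma> x y \<and> r y < r x}" for x
  define R where "R = {x \<in> ?V. card (low x) \<ge> 2}"
  have fin: "finite (low x)" for x
    by (rule finite_subset[of _ ?V]) (auto simp: low_def dest: adj_verts[OF wf])
  have one: "y = z" if "x \<in> ?V - R" "adj \<Gamma> x y" "adj \<Gamma> x z" "r y < r x" "r z < r x" for x y z
  proof (rule ccontr)
    assume "y \<noteq> z"
    then have "card {y, z} = 2" by simp
    moreover have "card {y, z} \<le> card (low x)"
      using that by (intro card_mono fin) (auto simp: low_def)
    ultimately show False using that(1) by (simp add: R_def)
  qed
  have "root \<notin> R"
  proof -
    have "low root = {}" using root_le adj_verts(2)[OF wf] by (fastforce simp: low_def)
    then show ?thesis by (simp add: R_def)
  qed
  then have "R \<subseteq> ?V - {root}" by (auto simp: R_def)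
  then have RV: "(\<Sum>x\<in>?V - {root}. of_bool (x \<in> R)) = card R"
    by (subst sum.mono_neutral_right[of _ R]) auto
  have "card (?V - {root}) + card R = (\<Sum>x\<in>?V - {root}. 1 + of_bool (x \<in> R))"
    unfolding sum.distrib RV by simp
  also have "\<dots> \<le> (\<Sum>x\<in>?V - {root}. card (low x))"
  proof (rule sum_mono)
    fix x assume x: "x \<in> ?V - {root}"
    then have "low x \<noteq> {}" using parent[of x] by (auto simp: low_def)
    then have "card (low x) \<ge> 1" using fin[of x] by (simp add: Suc_le_eq card_gt_0_iff)
    then show "1 + of_bool (x \<in> R) \<le> card (low x)" by (auto simp: R_def)
  qed
  also have "\<dots> \<le> (\<Sum>x\<in>?V. card (low x))" by (rule sum_mono2) auto
  also have "\<dots> = card (SIGMA x:?V. low x)" using fin by simp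
  also have "\<dots> \<le> card (edges \<Gamma>)"
  proof (rule card_inj_on_le[where f = "\<lambda>(x, y). {x, y}"])
    \<comment> \<open>The ranks of the two ends determine which of them comes first in the
      pair.\<close>
    show "inj_on (\<lambda>(x, y). {x, y}) (SIGMA x:?V. low x)"
      by (auto simp: inj_on_def low_def doubleton_eq_iff)
    show "(\<lambda>(x, y). {x, y}) ` (SIGMA x:?V. low x) \<subseteq> edges \<Gamma>"
      by (auto simp: low_def adj_def)
    have "edges \<Gamma> \<subseteq> Pow ?V" using wf by (auto simp: wf_signed_graph_def)
    then show "finite (edges \<Gamma>)" by (rule finite_subset) simp
  qed
  finally have card: "int (card R) \<le> cyclomatic \<Gamma>"
    using card_Suc_Diff1[OF finite_verts root] by (simp add: cyclomatic_def)
  have "R \<subseteq> ?V" by (auto simp: R_def)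
  then show thesis by (rule that[OF _ card inj]) (rule one)
qed

lemma cheeger_le:
  assumes m: "m \<ge> 1" and F: "card F \<ge> m" "disjoint F"
    and cuts: "\<And>C. C \<in> F \<Longrightarrow> C \<subseteq> verts \<Gamma> \<and>
      (\<exists>A B. A \<inter> B = {} \<and> A \<union> B \<noteq> {} \<and> A \<union> B \<subseteq> C \<and> beta \<Gamma> A B \<le> h)"
  shows "cheeger \<Gamma> m \<le> h"
proof -
  obtain A B where AB: "\<And>C. C \<in> F \<Longrightarrow> A C \<inter> B C = {} \<and> A C \<union> B C \<noteq> {} \<and> A C \<union> B C \<subseteq> C \<and> beta \<Gamma> (A C) (B C) \<le> h"
    using cuts by metis
  obtain F' where F': "F' \<subseteq> F" "card F' = m" "finite F'"
    using obtain_subset_with_card_n[OF F(1)] by metis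
  then obtain c where c: "bij_betw c {1..m} F'"
    using finite_same_card_bij[of "{1..m}" F'] by auto
  \<comment> \<open>The pair chosen for \<open>c l\<close> is stored at the indices
    \<open>2 * l - 1\<close> and \<open>2 * l\<close>; both divisions return
    \<open>l\<close>.\<close>
  define V where "V i = (if odd i then A (c (Suc i div 2)) else B (c (i div 2)))" for i
  have odd: "V (2 * l - 1) = A (c l)" if "l \<in> {1..m}" for l
    using that by (cases l) (auto simp: V_def)
  have even: "V (2 * l) = B (c l)" for l by (simp add: V_def)
  have cF: "c l \<in> F" if "l \<in> {1..m}" for l using bij_betwE[OF c] F'(1) that by blast
  have sub: "sub_bipartition \<Gamma> m V"
    unfolding sub_bipartition_def
  proof (intro conjI ballI impI)
    fix i assume i: "i \<in> {1..2 * m}"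
    show "V i \<subseteq> verts \<Gamma>"
    proof (cases "odd i")
      case True
      then have "Suc i div 2 \<in> {1..m}" using i by auto presburger
      then show ?thesis using True AB[OF cF] cuts[OF cF] unfolding V_def by simp blast
    next
      case False
      then have "i div 2 \<in> {1..m}" using i by auto
      then show ?thesis using False AB[OF cF] cuts[OF cF] unfolding V_def by simp blast
    qed
  next
    fix l assume l: "l \<in> {1..m}"
    show "V (2 * l - 1) \<inter> V (2 * l) = {}" "V (2 * l - 1) \<union> V (2 * l) \<noteq> {}"
      using AB[OF cF[OF l]] unfolding odd[OF l] even by auto
  next
    fix i j assume ij: "i \<in> {1..m}" "j \<in> {1..m}" "i \<noteq> j"
    then have "c i \<noteq> c j" using bij_betw_imp_inj_on[OF c] by (simp add: inj_on_eq_iff)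
    then have "c i \<inter> c j = {}" by (rule disjointD[OF F(2) cF[OF ij(1)] cF[OF ij(2)]])
    then show "(V (2 * i - 1) \<union> V (2 * i)) \<inter> (V (2 * j - 1) \<union> V (2 * j)) = {}"
      using AB[OF cF[OF ij(1)]] AB[OF cF[OF ij(2)]] unfolding odd[OF ij(1)] odd[OF ij(2)] even by blast
  qed
  let ?val = "\<lambda>V. (\<lambda>i. beta \<Gamma> (V (2 * i - 1)) (V (2 * i))) ` {1..m}"
  \<comment> \<open>\<open>Min\<close> is a lower bound only for a finite set. The functions
    \<open>V\<close> are arbitrary outside \<open>{1..2 * m}\<close>, hence infinite in number, but
    their values of \<open>beta\<close> come from this finite set.\<close>
  let ?all = "(\<lambda>(A, B). beta \<Gamma> A B) ` (Pow (verts \<Gamma>) \<times> Pow (verts \<Gamma>))"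
  have "{Max (?val V) | V. sub_bipartition \<Gamma> m V} \<subseteq> Max ` Pow ?all"
  proof clarify
    fix V assume V: "sub_bipartition \<Gamma> m V"
    have "?val V \<subseteq> ?all"
    proof clarify
      fix i assume i: "i \<in> {1..m}"
      then have "2 * i - 1 \<in> {1..2 * m}" "2 * i \<in> {1..2 * m}" by auto
      then have "V (2 * i - 1) \<subseteq> verts \<Gamma>" "V (2 * i) \<subseteq> verts \<Gamma>"
        using V unfolding sub_bipartition_def by blast+
      then show "beta \<Gamma> (V (2 * i - 1)) (V (2 * i)) \<in> ?all" 
        by (intro image_eqI[of _ _ "(V (2 * i - 1), V (2 * i))"]) auto
    qed
    then show "Max (?val V) \<in> Max ` Pow ?all" by blast
  qed
  then have "finite {Max (?val V) | V. sub_bipartition \<Gamma> m V}"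
    by (rule finite_subset) simp
  then have "cheeger \<Gamma> m \<le> Max (?val V)"
    unfolding cheeger_def using sub by (intro Min_le) blast+
  also have "\<dots> \<le> h"
    using m AB[OF cF] by (subst Max_le_iff) (auto simp: odd even simp del: One_nat_def)
  finally show ?thesis .
qed

theorem theorem6p1:
  fixes \<Gamma> :: signed_graph and k :: nat
  assumes "wf_signed_graph \<Gamma>"
    and "connected_graph \<Gamma>"
    and "\<forall>x\<in>verts \<Gamma>. potential \<Gamma> x \<ge> 0"
    and "cyclomatic \<Gamma> + 1 \<le> int k"
    and "k \<le> nverts \<Gamma>"
  shows "cheeger \<Gamma> (nat (int k - cyclomatic \<Gamma>)) \<le> sqrt (2 * tau \<Gamma> * eigenvalue_seq \<Gamma> k)"
proof -
  let ?V = "verts \<Gamma>" and ?H = "laplacian_entry \<Gamma>" and ?\<mu> = "vmeasure \<Gamma>"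
  let ?l = "eigenvalue_seq \<Gamma> k"
  define N where "N f = (\<Sum>x\<in>?V. ?\<mu> x * (f x)\<^sup>2)" for f
  \<comment> \<open>On functions of positive norm, nonpositivity of this form says that the Rayleigh
    quotient is at most the k-th eigenvalue.\<close>
  define B where "B x y = ?H x y - (if x = y then ?l * ?\<mu> x else 0)" for x y
  have sym: "B x y = B y x" for x y by (simp add: B_def laplacian_entry_commute[of \<Gamma> x])
  have qB: "quad_form ?V B f = quad_form ?V ?H f - ?l * N f" for f
  proof -
    have "(\<Sum>y\<in>?V. B x y * f x * f y) = (\<Sum>y\<in>?V. ?H x y * f x * f y) - ?l * (?\<mu> x * (f x)\<^sup>2)" if "x \<in> ?V" for x
    proof -
      have "(\<Sum>y\<in>?V. B x y * f x * f y) =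
          (\<Sum>y\<in>?V. ?H x y * f x * f y - (if x = y then ?l * (?\<mu> x * (f x)\<^sup>2) else 0))"
        by (intro sum.cong) (auto simp: B_def algebra_simps power2_eq_square)
      then show ?thesis using that by (simp add: sum_subtractf)
    qed
    then show ?thesis by (simp add: quad_form_def N_def sum_subtractf sum_distrib_left)
  qed
  obtain es where es: "sorted es" "length es = nverts \<Gamma>"
    "char_poly (mat (nverts \<Gamma>) (nverts \<Gamma>) (\<lambda>(i, j). ?H i j / ?\<mu> i)) = (\<Prod>e\<leftarrow>es. [:- e, 1:])"
    using weighted_symmetric_char_poly_splits[of ?H "nverts \<Gamma>" ?\<mu>]
      laplacian_entry_commute vmeasure_pos[OF assms(1)] by (auto simp: verts_def)
  have l: "?l = es ! (k - 1)"
    by (simp only: eigenvalue_seq_def normalized_laplacian_eq es(3) sorted_proots_eq[OF es(1)])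
  obtain R and r :: "nat \<Rightarrow> nat" where R: "R \<subseteq> ?V" "int (card R) \<le> cyclomatic \<Gamma>"
    and inj: "inj_on r ?V"
    and low: "\<And>x y z. \<lbrakk>x \<in> ?V - R; adj \<Gamma> x y; adj \<Gamma> x z; r y < r x; r z < r x\<rbrakk> \<Longrightarrow> y = z"
    using feedback_vertex_set[OF assms(1,2)] by metis
  \<comment> \<open>The strict rank inequality excludes the diagonal, which is the only place where
    the shift, the degree and the potential enter.\<close>
  have adjB: "adj \<Gamma> x y" if "B x y \<noteq> 0" "r y < r x" for x y
    using that by (auto simp: B_def laplacian_entry_def edge_weight_def split: if_splits)
  have "forest_order B r (?V - R)"
    unfolding forest_order_def using inj low adjB by (blast intro: inj_on_subset)
  then obtain S F where S: "S \<subseteq> ?V - R" "card S \<le> card F" "disjoint F"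
    and npd: "\<And>C. C \<in> F \<Longrightarrow> C \<subseteq> ?V - R \<and> \<not> pos_def_on ?V B C"
    and pd: "pos_def_on ?V B (?V - R - S)"
    using forest_packing[of "?V - R" B r ?V] sym by auto
  \<comment> \<open>Otherwise the min-max function vanishing on \<open>R \<union> S\<close> would
    have a nonpositive form although its support lies where \<open>B\<close> is positive
    definite.\<close>
  have "k \<le> card (R \<union> S)"
  proof (rule ccontr)
    assume "\<not> k \<le> card (R \<union> S)"
    then have "card (R \<union> S) < k" by simp
    moreover have "finite (R \<union> S)" using R(1) S(1) by (auto intro: finite_subset)
    ultimately obtain f where f: "\<exists>x. f x \<noteq> 0" "\<forall>x\<ge>nverts \<Gamma>. f x = 0" "\<forall>x\<in>R \<union> S. f x = 0"
      "quad_form {..<nverts \<Gamma>} ?H f \<le> es ! (k - 1) * (\<Sum>x<nverts \<Gamma>. ?\<mu> x * (f x)\<^sup>2)"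
      using exists_rayleigh_le_vanishing[of ?H "nverts \<Gamma>" ?\<mu> es "R \<union> S" k] es assms(5)
        laplacian_entry_commute vmeasure_pos[OF assms(1)] by (auto simp: verts_def)
    have "quad_form ?V B f \<le> 0" using f(4) unfolding qB l by (simp add: N_def verts_def)
    moreover have "f x = 0" if "x \<notin> ?V - R - S" for x
      using that f(2,3) by (auto simp: verts_def not_less)
    ultimately show False using f(1) pos_def_onD[OF pd, of f] by force
  qed
  also have "card (R \<union> S) \<le> card R + card S" by (rule card_Un_le)
  finally have "nat (int k - cyclomatic \<Gamma>) \<le> card F" using R(2) S(2) by linarith
  then show ?thesis
  proof (rule cheeger_le[rotated])
    show "nat (int k - cyclomatic \<Gamma>) \<ge> 1" using assms(4) by simp
    fix C assume C: "C \<in> F"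
    then obtain f where f: "\<forall>x. x \<notin> C \<longrightarrow> f x = 0" "\<exists>x. f x \<noteq> 0" "\<not> quad_form ?V B f > 0"
      using npd unfolding pos_def_on_def by blast
    have "quad_form ?V ?H f \<le> ?l * (\<Sum>x\<in>?V. ?\<mu> x * (f x)\<^sup>2)"
      using f(3) unfolding qB N_def by simp
    then show "C \<subseteq> ?V \<and> (\<exists>A B. A \<inter> B = {} \<and> A \<union> B \<noteq> {} \<and> A \<union> B \<subseteq> C \<and> beta \<Gamma> A B \<le> sqrt (2 * tau \<Gamma> * ?l))"
      using cheeger_cut[OF assms(1), of C f ?l] assms(3) npd[OF C] f(1,2) by blast
  qed (fact S(3))
qed

end
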